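(* Let $\ell\ge 4$, $s\ge 0$ and $r\ge 2$ be integers and let $k=\lfloor (\ell-2)/2\rfloor$. Then for all sufficiently large $n$ the following hold. (a) If $\ell$ is even, then $\mathrm{ex}_r(n,B(\ell,s))=e_r(H(k,n))$, and $H(k,n)$ is the unique extremal graph. (b) If $\ell$ is odd and either $\ell\ge 7$, or $\ell=5$ and $s=0$, then $\mathrm{ex}_r(n,B(\ell,s))=e_r(H^*(k,n))$, and $H^*(k,n)$ is the unique extremal graph. (c) If $\ell=5$ and $s>0$, then $\mathrm{ex}_r(n,B(\ell,s))=e_r(F_n)$, and $F_n$ is the unique extremal graph.
   Context: For a graph $G$ with degree sequence $d_1,\dots,d_n$ and a positive integer $r$, $e_r(G)=\sum_{i=1}^n d_i^r$. For a graph $F$, $\mathrm{ex}_r(n,F)$ is the maximum of $e_r(G)$ over all $n$-vertex graphs $G$ containing no copy of $F$ (as a subgraph); an extremal graph is an $n$-vertex $F$-free graph attaining this maximum. The broom $B(\ell,s)$ is the graph obtained from a path $P_\ell$ on $\ell$ vertices by adding $s$ new vertices, each joined only to a penultimate vertex of the path (a neighbor of an endpoint). $H(k,n)$ is the $n$-vertex graph obtained from the complete bipartite graph $K_{k,n-k}$ by adding all edges inside the part of size $k$ (so $k$ vertices have degree $n-1$ and $n-k$ vertices have degree $k$). $H^*(k,n)$ is obtained from $H(k,n)$ by adding one edge (necessarily between two vertices of the part of size $n-k$). $S_n$ is the star on $n$ vertices, and $F_n$ is the graph obtained from $S_n$ by adding $\lfloor (n-1)/2\rfloor$ pairwise disjoint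 edges among the leaves. *)

theory Defs
  imports Main
begin

type_synonym 'a graph = "'a set \<times> 'a set set"

definition verts :: "'a graph \<Rightarrow> 'a set" where "verts G = fst G"
definition edges :: "'a graph \<Rightarrow> 'a set set" where "edges G = snd G"

definition simple_graph :: "'a graph \<Rightarrow> bool" where
  "simple_graph G \<longleftrightarrow> finite (verts G) \<and>
     (\<forall>e\<in>edges G. \<exists>u v. u \<in> verts G \<and> v \<in> verts G \<and> u \<noteq> v \<and> e = {u, v})"

definition degree :: "'a graph \<Rightarrow> 'a \<Rightarrow> nat" where
  "degree G v = card {e \<in> edges G. v \<in> e}"

definition e_r :: "nat \<Rightarrow> 'a graph \<Rightarrow> nat" where
  "e_r r G = (\<Sum>v\<in>verts G. degree G v ^ r)"

definition contains :: "'a graph \<Rightarrow> 'b graph \<Rightarrow> bool" where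
  "contains G F \<longleftrightarrow> (\<exists>f. inj_on f (verts F) \<and> f ` verts F \<subseteq> verts G \<and>
      (\<forall>u\<in>verts F. \<forall>v\<in>verts F. {u, v} \<in> edges F \<longrightarrow> {f u, f v} \<in> edges G))"

definition isomorphic :: "'a graph \<Rightarrow> 'b graph \<Rightarrow> bool" where
  "isomorphic G H \<longleftrightarrow> (\<exists>f. bij_betw f (verts G) (verts H) \<and>
      (\<forall>u\<in>verts G. \<forall>v\<in>verts G. {u, v} \<in> edges G \<longleftrightarrow> {f u, f v} \<in> edges H))"

definition nvertex_graph :: "nat \<Rightarrow> nat graph \<Rightarrow> bool" where
  "nvertex_graph n G \<longleftrightarrow> simple_graph G \<and> verts G = {0..<n}"

definition ex_r :: "nat \<Rightarrow> nat \<Rightarrow> 'b graph \<Rightarrow> nat" where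
  "ex_r r n F = Max (e_r r ` {G. nvertex_graph n G \<and> \<not> contains G F})"

definition extremal :: "nat \<Rightarrow> nat \<Rightarrow> 'b graph \<Rightarrow> nat graph \<Rightarrow> bool" where
  "extremal r n F G \<longleftrightarrow> nvertex_graph n G \<and> \<not> contains G F \<and> e_r r G = ex_r r n F"

definition broom :: "nat \<Rightarrow> nat \<Rightarrow> nat graph" where
  "broom l s = ({0..<l+s},
      {{i, i+1} | i. i + 1 < l} \<union> {{1, j} | j. l \<le> j \<and> j < l + s})"

text \<open>H(k,n): clique on {0..<k}, completely joined to the independent set {k..<n}.\<close>
definition H_graph :: "nat \<Rightarrow> nat \<Rightarrow> nat graph" where
  "H_graph k n = ({0..<n}, {{u, v} | u v. u < n \<and> v < n \<and> u \<noteq> v \<and> (u < k \<or> v < k)})"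

definition H_star :: "nat \<Rightarrow> nat \<Rightarrow> nat graph" where
  "H_star k n = ({0..<n}, edges (H_graph k n) \<union> {{k, k+1}})"

definition F_graph :: "nat \<Rightarrow> nat graph" where
  "F_graph n = ({0..<n}, {{0, v} | v. 1 \<le> v \<and> v < n} \<union>
      {{2*i - 1, 2*i} | i. 1 \<le> i \<and> i \<le> (n - 1) div 2})"

end

theory Submission
  imports Defs Complex_Main
begin

text \<open>
  A broom-free graph is degenerate, so its degree sum is linear in \<open>n\<close>, and it contains no
  \<open>K\<^bsub>k+1,M\<^esub>\<close> for a suitable constant \<open>M\<close>, so the vertices of linear degree have total degree at
  most \<open>kn + O(1)\<close>. If the degree power sum is at least \<open>k(n-1)\<^sup>r\<close>, convexity forces \<open>k\<close> vertices of
  degree at least \<open>(1-\<epsilon>)n\<close>; let \<open>A\<close> be the set of these and \<open>q\<close> the number of edges at \<open>A\<close> that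
  are missing. Paths alternating between \<open>A\<close> and the common neighbours of \<open>A\<close> turn any superfluous
  edge outside \<open>A\<close> into a broom. Hence all but \<open>O(q)\<close> vertices outside \<open>A\<close> have at most the degree
  that they have in the extremal graph, and these exceptional vertices contribute at most
  \<open>O(\<epsilon>qn\<^bsup>r-1\<^esup>)\<close>, while \<open>q\<close> missing edges cost at least \<open>q(n-1)\<^bsup>r-1\<^esup>\<close>. So \<open>q = 0\<close>, and
  then the graph embeds into the claimed extremal graph.
\<close>

subsection \<open>Neighbourhoods and degeneracy\<close>

text \<open>The brush costs nothing if the second vertex of the path lies in \<open>A\<close>,
  because vertices of \<open>A\<close> have neighbours to spare. So a broom is sought as a path
  \<open>w, a, ...\<close> alternating between common neighbours and all of \<open>A\<close>: it has
  2k vertices and ends in \<open>A\<close>, and an outside path on 2 vertices (\<open>l\<close>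
  even) or 3 vertices (\<open>l\<close> odd) attached there completes it. For odd \<open>l\<close>
  this alone still permits a matching among the common neighbours. If \<open>k \<ge> 2\<close>, one
  edge between common neighbours can be spliced into the alternating path, which gains a vertex, and
  a second disjoint edge as tail then completes the broom; hence only one extra edge survives. If
  \<open>k = 1\<close>, splicing puts a vertex of small degree in second place, which is harmless
  only for \<open>s = 0\<close>; this is why \<open>F_graph\<close> appears for \<open>l = 5\<close>
  and \<open>s > 0\<close>. The number of exceptional vertices has to be bounded by a multiple of
  the number of missing edges, not merely by a small fraction of \<open>n\<close>: otherwise a graph
  with very few missing edges could not be excluded.\<close>

definition nbr :: "'a graph \<Rightarrow> 'a \<Rightarrow> 'a set" where
  "nbr G v = {u. {v, u} \<in> edges G}"

lemma nbr_sym: "u \<in> nbr G v \<longleftrightarrow> v \<in> nbr G u"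
  by (simp add: nbr_def insert_commute)

lemma finite_verts: "simple_graph G \<Longrightarrow> finite (verts G)"
  by (simp add: simple_graph_def)

lemma nbr_subset: "simple_graph G \<Longrightarrow> nbr G v \<subseteq> verts G - {v}"
  unfolding simple_graph_def nbr_def by (fastforce simp: doubleton_eq_iff)

lemma finite_nbr: "simple_graph G \<Longrightarrow> finite (nbr G v)"
  using nbr_subset finite_verts by (metis finite_Diff finite_subset)

lemma nbr_in_verts: "simple_graph G \<Longrightarrow> u \<in> nbr G v \<Longrightarrow> u \<in> verts G \<and> v \<in> verts G \<and> u \<noteq> v"
  using nbr_subset nbr_sym by fastforce

lemma degree_eq_card_nbr:
  assumes "simple_graph G" shows "degree G v = card (nbr G v)"
proof -
  have "{e \<in> edges G. v \<in> e} = (\<lambda>u. {v, u}) ` nbr G v"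
  proof
    show "{e \<in> edges G. v \<in> e} \<subseteq> (\<lambda>u. {v, u}) ` nbr G v"
    proof
      fix e assume e: "e \<in> {e \<in> edges G. v \<in> e}"
      then obtain a b where "e = {a, b}" using assms unfolding simple_graph_def by blast
      with e have "e = {v, a} \<or> e = {v, b}" by auto
      with e show "e \<in> (\<lambda>u. {v, u}) ` nbr G v" by (auto simp: nbr_def)
    qed
  qed (auto simp: nbr_def)
  moreover have "inj_on (\<lambda>u. {v, u}) (nbr G v)"
    by (auto simp: inj_on_def doubleton_eq_iff)
  ultimately show ?thesis by (simp add: degree_def card_image)
qed

lemma degree_less:
  assumes "simple_graph G" "v \<in> verts G"
  shows "degree G v \<le> card (verts G) - 1"
proof -
  have "degree G v \<le> card (verts G - {v})"
    unfolding degree_eq_card_nbr[OF assms(1)]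
    using nbr_subset[OF assms(1)] finite_verts[OF assms(1)] by (intro card_mono) auto
  then show ?thesis using assms by (simp add: finite_verts)
qed

text \<open>The broom is a tree in which each vertex \<open>j > 0\<close> has exactly one smaller
  neighbour: \<open>j - 1\<close> on the path, \<open>1\<close> for a brush vertex. An embedding
  listed in this order needs one adjacency per index, which suits a greedy construction.\<close>

lemma contains_broom_of_list:
  assumes "l \<ge> 2" "distinct xs" "length xs = l + s" "set xs \<subseteq> verts G"
    and adj: "\<And>j. 0 < j \<Longrightarrow> j < l + s \<Longrightarrow> xs ! j \<in> nbr G (xs ! (if j < l then j - 1 else 1))"
  shows "contains G (broom l s)"
  unfolding contains_def
proof (intro exI conjI ballI impI)
  have v: "verts (broom l s) = {0..<l+s}" by (simp add: broom_def verts_def)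
  show "inj_on (nth xs) (verts (broom l s))"
    using assms by (simp add: v inj_on_def nth_eq_iff_index_eq)
  show "nth xs ` verts (broom l s) \<subseteq> verts G"
    using assms by (auto simp: v)
  fix u w assume e: "{u, w} \<in> edges (broom l s)"
  have *: "{xs ! i, xs ! Suc i} \<in> edges G" if "Suc i < l" for i
    using adj[of "Suc i"] that by (auto simp: nbr_def)
  have **: "{xs ! 1, xs ! j} \<in> edges G" if "l \<le> j" "j < l + s" for j
    using adj[of j] that assms(1) by (auto simp: nbr_def)
  from e show "{xs ! u, xs ! w} \<in> edges G"
    using * ** by (auto simp: broom_def edges_def doubleton_eq_iff insert_commute)
qed

definition walk :: "'a graph \<Rightarrow> 'a list \<Rightarrow> bool" where
  "walk G p \<longleftrightarrow> successively (\<lambda>u v. v \<in> nbr G u) p"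

text \<open>The path occupies \<open>l\<close> vertices, so degree \<open>s + l\<close> at its
  second vertex leaves \<open>s\<close> neighbours for the brush. The alternative
  \<open>s = 0\<close> serves a path on five vertices whose second vertex may have small
  degree.\<close>

lemma contains_broom_of_path:
  assumes G: "simple_graph G" and "walk G p" "distinct p" "set p \<subseteq> verts G" "length p = l" "l \<ge> 2"
    and "s + l \<le> degree G (p ! 1) \<or> s = 0"
  shows "contains G (broom l s)"
proof -
  have "s \<le> card (nbr G (p ! 1) - set p)"
    using assms(7)
  proof
    assume "s + l \<le> degree G (p ! 1)"
    moreover have "card (nbr G (p ! 1)) - card (set p) \<le> card (nbr G (p ! 1) - set p)"
      by (rule diff_card_le_card_Diff) simp
    ultimately show ?thesis using assms by (simp add: degree_eq_card_nbr distinct_card)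
  qed simp
  then obtain S where S: "S \<subseteq> nbr G (p ! 1) - set p" "card S = s" "finite S"
    by (metis obtain_subset_with_card_n)
  obtain ys where ys: "set ys = S" "distinct ys" using S finite_distinct_list by blast
  have len: "length ys = s" using S ys distinct_card by fastforce
  show ?thesis
  proof (rule contains_broom_of_list[of l "p @ ys"])
    show "set (p @ ys) \<subseteq> verts G" using assms S ys nbr_subset[OF G] by auto
    fix j assume j: "0 < j" "j < l + s"
    show "(p @ ys) ! j \<in> nbr G ((p @ ys) ! (if j < l then j - 1 else 1))"
    proof (cases "j < l")
      case True
      then have "p ! j \<in> nbr G (p ! (j - 1))"
        using \<open>walk G p\<close> j assms unfolding walk_def successively_conv_nth
        by (metis Suc_diff_1)
      moreover have "j - 1 < l" using True by simp
      ultimately show ?thesis using True assms(5) by (simp add: nth_append)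
    next
      case False
      then have "ys ! (j - l) \<in> S" using j len ys by (metis less_diff_conv2 linorder_not_less nth_mem add.commute)
      with False assms S show ?thesis by (auto simp: nth_append)
    qed
  qed (use assms S ys len in auto)
qed

text \<open>Otherwise every vertex of \<open>S\<close> has more neighbours in \<open>S\<close> than
  vertices have been placed so far, and the broom is embedded greedily, each vertex next to its
  already placed parent.\<close>

lemma broom_free_degenerate:
  assumes G: "simple_graph G" and free: "\<not> contains G (broom l s)" and "l \<ge> 2"
    and S: "S \<subseteq> verts G" "S \<noteq> {}"
  shows "\<exists>v\<in>S. card (nbr G v \<inter> S) < l + s"
proof (rule ccontr)
  assume "\<not> ?thesis"
  then have big: "l + s \<le> card (nbr G v \<inter> S)" if "v \<in> S" for v
    using that by force
  let ?ok = "\<lambda>m xs. distinct xs \<and> length xs = m \<and> set xs \<subseteq> S \<and>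
      (\<forall>j. 0 < j \<longrightarrow> j < m \<longrightarrow> xs ! j \<in> nbr G (xs ! (if j < l then j - 1 else 1)))"
  have "\<exists>xs. ?ok m xs" if "m \<le> l + s" for m
    using that
  proof (induction m)
    case (Suc m)
    then obtain xs where "?ok m xs" by (meson Suc_leD)
    then have xs: "distinct xs" "length xs = m" "set xs \<subseteq> S"
      and adj: "\<And>j. 0 < j \<Longrightarrow> j < m \<Longrightarrow> xs ! j \<in> nbr G (xs ! (if j < l then j - 1 else 1))"
      by blast+
    obtain w where w: "w \<in> S - set xs" "m > 0 \<Longrightarrow> w \<in> nbr G (xs ! (if m < l then m - 1 else 1))"
    proof (cases "m = 0")
      case True
      with S xs show thesis using that by auto
    next
      case False
      let ?v = "xs ! (if m < l then m - 1 else 1)"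
      have "(if m < l then m - 1 else 1) < length xs" using xs False \<open>l \<ge> 2\<close> by auto
      then have "?v \<in> S" using xs(3) nth_mem by blast
      then have "card (set xs) < card (nbr G ?v \<inter> S)"
        using big Suc.prems xs distinct_card by fastforce
      then have "\<not> nbr G ?v \<inter> S \<subseteq> set xs"
        by (metis List.finite_set card_mono linorder_not_less)
      then show thesis using that by blast
    qed
    have "(xs @ [w]) ! j \<in> nbr G ((xs @ [w]) ! (if j < l then j - 1 else 1))"
      if "0 < j" "j < Suc m" for j
    proof (cases "j = m")
      case True
      then show ?thesis using w(2) that xs(2) \<open>l \<ge> 2\<close> by (auto simp: nth_append)
    next
      case False
      then have "j < m" using that by simp
      moreover have "(if j < l then j - 1 else 1) < m" using \<open>j < m\<close> \<open>l \<ge> 2\<close> by auto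
      ultimately show ?thesis using adj[OF \<open>0 < j\<close> \<open>j < m\<close>] xs(2) by (simp only: nth_append if_True)
    qed
    then have "?ok (Suc m) (xs @ [w])" using xs w(1) by simp
    then show ?case by blast
  qed simp
  then obtain xs where "?ok (l + s) xs" by blast
  then have "contains G (broom l s)"
    using \<open>l \<ge> 2\<close> S by (intro contains_broom_of_list[of l xs]) blast+
  with free show False ..
qed

text \<open>Deleting a vertex with fewer than \<open>l + s\<close> neighbours in \<open>S\<close>
  lowers the sum, which counts edges inside \<open>S\<close> twice, by less than
  \<open>2 * (l + s)\<close>. The set \<open>S\<close> is arbitrary because the bound is applied
  both to the whole graph and to the exceptional vertices.\<close>

lemma broom_free_edge_bound:
  assumes G: "simple_graph G" and free: "\<not> contains G (broom l s)" and "l \<ge> 2"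
    and S: "S \<subseteq> verts G"
  shows "(\<Sum>v\<in>S. card (nbr G v \<inter> S)) \<le> 2 * (l + s) * card S"
  using finite_subset[OF S finite_verts[OF G]] S
proof (induction S rule: finite_remove_induct)
  case (remove S)
  then obtain v where v: "v \<in> S" "card (nbr G v \<inter> S) < l + s"
    using broom_free_degenerate[OF G free \<open>l \<ge> 2\<close>] by metis
  have one: "card (nbr G u \<inter> S) = card (nbr G u \<inter> (S - {v})) + (if u \<in> nbr G v then 1 else 0)"
    if "u \<in> S - {v}" for u
  proof (cases "u \<in> nbr G v")
    case True
    then have "nbr G u \<inter> S = insert v (nbr G u \<inter> (S - {v}))" using v by (auto simp: nbr_sym)
    moreover have "finite (nbr G u \<inter> (S - {v}))" using remove by auto
    ultimately show ?thesis using True by simp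
  next
    case False
    then have "nbr G u \<inter> S = nbr G u \<inter> (S - {v})" by (auto simp: nbr_sym)
    then show ?thesis using False by simp
  qed
  have "(\<Sum>u\<in>S - {v}. if u \<in> nbr G v then 1 else 0) = card (nbr G v \<inter> S)"
  proof -
    have "nbr G v \<inter> S = {u \<in> S - {v}. u \<in> nbr G v}" using nbr_subset[OF G] by auto
    then show ?thesis using remove.hyps(1) by (simp add: sum.If_cases Int_def)
  qed
  then have "(\<Sum>u\<in>S. card (nbr G u \<inter> S))
      = 2 * card (nbr G v \<inter> S) + (\<Sum>u\<in>S - {v}. card (nbr G u \<inter> (S - {v})))"
    using remove.hyps(1) v(1) by (simp add: sum.remove[of S v] one sum.distrib)
  also have "\<dots> \<le> 2 * (l + s) + 2 * (l + s) * card (S - {v})"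
    using v remove.IH[of v] remove.prems by (intro add_mono) auto
  also have "\<dots> = 2 * (l + s) * card S"
    using v remove.hyps(1) by (metis card_Suc_Diff1 mult_Suc_right)
  finally show ?case .
qed simp

subsection \<open>Vertices of almost full degree\<close>

text \<open>Edges at \<open>A\<close> are counted from their other end. A vertex with more than
  \<open>k\<close> neighbours in \<open>A\<close> is a common neighbour of some \<open>k + 1\<close>
  elements of \<open>A\<close>, so at most \<open>2 ^ card A * M\<close> vertices are of this
  kind.\<close>

lemma sum_degree_bound_no_biclique:
  assumes G: "simple_graph G" and A: "A \<subseteq> verts G"
    and noK: "\<And>S. S \<subseteq> verts G \<Longrightarrow> card S = k + 1 \<Longrightarrow> card (\<Inter>v\<in>S. nbr G v) < M"
  shows "(\<Sum>a\<in>A. degree G a) \<le> k * card (verts G) + card A * (2 ^ card A * M)"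
proof -
  let ?V = "verts G"
  note fV = finite_verts[OF G]
  have fA: "finite A" using A fV finite_subset by blast
  define Bad where "Bad = {v \<in> ?V. k + 1 \<le> card (nbr G v \<inter> A)}"
  have "Bad \<subseteq> (\<Union>S\<in>{S. S \<subseteq> A \<and> card S = k + 1}. \<Inter>v\<in>S. nbr G v)"
  proof
    fix v assume "v \<in> Bad"
    then obtain S where "S \<subseteq> nbr G v \<inter> A" "card S = k + 1"
      unfolding Bad_def by (smt (verit) mem_Collect_eq obtain_subset_with_card_n)
    then show "v \<in> (\<Union>S\<in>{S. S \<subseteq> A \<and> card S = k + 1}. \<Inter>v\<in>S. nbr G v)"
      by (auto simp: nbr_sym[of v] subset_iff)
  qed
  moreover have fS: "finite {S. S \<subseteq> A \<and> card S = k + 1}" using fA by simp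
  moreover have "finite (\<Union>S\<in>{S. S \<subseteq> A \<and> card S = k + 1}. \<Inter>v\<in>S. nbr G v)"
  proof (rule finite_UN_I[OF fS])
    fix S assume "S \<in> {S. S \<subseteq> A \<and> card S = k + 1}"
    then have "S \<noteq> {}" by auto
    then show "finite (\<Inter>v\<in>S. nbr G v)" using finite_nbr[OF G] by (meson finite_INT all_not_in_conv)
  qed
  ultimately have "card Bad \<le> card (\<Union>S\<in>{S. S \<subseteq> A \<and> card S = k + 1}. \<Inter>v\<in>S. nbr G v)"
    by (simp add: card_mono)
  also have "\<dots> \<le> (\<Sum>S\<in>{S. S \<subseteq> A \<and> card S = k + 1}. card (\<Inter>v\<in>S. nbr G v))"
    by (rule card_UN_le[OF fS])
  also have "\<dots> \<le> (\<Sum>S\<in>{S. S \<subseteq> A \<and> card S = k + 1}. M)"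
    using noK A by (intro sum_mono less_imp_le) auto
  also have "\<dots> \<le> card (Pow A) * M"
    using card_mono[of "Pow A" "{S. S \<subseteq> A \<and> card S = k + 1}"] fA by auto
  finally have bad: "card Bad \<le> 2 ^ card A * M" using fA by (simp add: card_Pow)
  have "(\<Sum>a\<in>A. degree G a) = (\<Sum>a\<in>A. \<Sum>v\<in>?V. if v \<in> nbr G a then 1 else 0)"
  proof (rule sum.cong)
    fix a
    have "nbr G a = {v \<in> ?V. v \<in> nbr G a}" using nbr_subset[OF G] by blast
    then show "degree G a = (\<Sum>v\<in>?V. if v \<in> nbr G a then 1 else 0)"
      using fV by (simp add: degree_eq_card_nbr[OF G] sum.If_cases Int_def)
  qed simp
  also have "\<dots> = (\<Sum>v\<in>?V. \<Sum>a\<in>A. if v \<in> nbr G a then 1 else 0)"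
    by (rule sum.swap)
  also have "\<dots> = (\<Sum>v\<in>?V. card (nbr G v \<inter> A))"
  proof (rule sum.cong)
    fix v
    have "nbr G v \<inter> A = {a \<in> A. v \<in> nbr G a}" by (auto simp: nbr_sym)
    then show "(\<Sum>a\<in>A. if v \<in> nbr G a then 1 else 0) = card (nbr G v \<inter> A)"
      using fA by (simp add: sum.If_cases Int_def)
  qed simp
  also have "\<dots> \<le> (\<Sum>v\<in>?V. k + (if v \<in> Bad then card A else 0))"
  proof (rule sum_mono)
    fix v assume "v \<in> ?V"
    then show "card (nbr G v \<inter> A) \<le> k + (if v \<in> Bad then card A else 0)"
      using card_mono[OF fA, of "nbr G v \<inter> A"] by (auto simp: Bad_def)
  qed
  also have "\<dots> = k * card ?V + card A * card Bad"
  proof -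
    have "?V \<inter> Bad = Bad" by (auto simp: Bad_def)
    then show ?thesis using fV by (simp add: sum.distrib sum.If_cases Int_def)
  qed
  finally show ?thesis using bad by (meson add_left_mono le_trans mult_le_mono2)
qed

text \<open>The bound \<open>d ^ r \<le> n ^ (r - 2) * d ^ 2\<close> reduces every exponent to 2,
  and by Bernoulli the passage from \<open>n - 1\<close> to \<open>n\<close> costs only a term
  linear in \<open>n\<close>.\<close>

lemma sum_squares_ge_of_sum_powers_ge:
  fixes d :: "'a \<Rightarrow> nat"
  assumes "r \<ge> 2" "n \<ge> 1" "\<And>v. v \<in> V \<Longrightarrow> d v \<le> n" "k * (n - 1) ^ r \<le> (\<Sum>v\<in>V. d v ^ r)"
  shows "real k * real n ^ 2 - real (k * r) * real n \<le> (\<Sum>v\<in>V. real (d v) ^ 2)"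
proof -
  have r: "m ^ r = m ^ (r - 2) * m ^ 2" for m :: real
    using \<open>r \<ge> 2\<close> by (metis le_add_diff_inverse2 power_add)
  have "1 - real r / real n \<le> (1 - 1 / real n) ^ r"
    using Bernoulli_inequality[of "- 1 / real n" r] \<open>n \<ge> 1\<close> by simp
  then have "real n ^ r * (1 - real r / real n) \<le> real n ^ r * (1 - 1 / real n) ^ r"
    by (intro mult_left_mono) auto
  also have "\<dots> = real (n - 1) ^ r"
    using \<open>n \<ge> 1\<close> by (simp add: right_diff_distrib of_nat_diff flip: power_mult_distrib)
  also have "real n ^ r * (1 - real r / real n) = real n ^ (r - 2) * (real n ^ 2 - real r * real n)"
    using \<open>n \<ge> 1\<close> unfolding r[of "real n"] by (simp add: field_simps power2_eq_square)
  finally have *: "real n ^ (r - 2) * (real n ^ 2 - real r * real n) \<le> real (n - 1) ^ r" .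
  have "real n ^ (r - 2) * (real k * (real n ^ 2 - real r * real n)) \<le> real k * real (n - 1) ^ r"
    using mult_left_mono[OF *, of "real k"] by (simp add: mult_ac)
  also have "\<dots> \<le> (\<Sum>v\<in>V. real (d v) ^ r)"
    using assms(4) by (metis (mono_tags, lifting) of_nat_le_iff of_nat_mult of_nat_power of_nat_sum sum.cong)
  also have "\<dots> \<le> (\<Sum>v\<in>V. real n ^ (r - 2) * real (d v) ^ 2)"
    unfolding r using assms(3) by (intro sum_mono mult_right_mono power_mono) auto
  also have "\<dots> = real n ^ (r - 2) * (\<Sum>v\<in>V. real (d v) ^ 2)"
    by (simp add: sum_distrib_left)
  finally have "real k * (real n ^ 2 - real r * real n) \<le> (\<Sum>v\<in>V. real (d v) ^ 2)"
    using \<open>n \<ge> 1\<close> by (simp add: mult_le_cancel_left)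
  then show ?thesis by (simp add: algebra_simps)
qed

text \<open>Since \<open>\<Sum> d(n - d)\<close> over the vertices of degree at least \<open>\<alpha>n\<close> is small, every degree is either at
  most \<open>\<beta>n\<close> or at least \<open>(1-\<beta>)n\<close>; the former contribute less than \<open>n\<^sup>2\<close> to the sum of squares.\<close>

lemma many_near_full_degrees:
  fixes d :: "'a \<Rightarrow> real" and n c \<alpha> \<beta> K L :: real and k :: nat
  assumes V: "finite V" "\<And>v. v \<in> V \<Longrightarrow> 0 \<le> d v \<and> d v \<le> n"
    and c: "c \<ge> 1" and \<alpha>: "\<alpha> > 0" and \<beta>: "\<beta> = 6 * c * \<alpha>" "\<beta> \<le> 1 / 2" "2 * c * \<beta> \<le> 1 / 2"
    and sum: "(\<Sum>v\<in>V. d v) \<le> 2 * c * n"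
    and sq: "real k * n ^ 2 - L * n \<le> (\<Sum>v\<in>V. d v ^ 2)"
    and hi: "(\<Sum>v\<in>{v\<in>V. \<alpha> * n \<le> d v}. d v) \<le> real k * n + K"
    and n: "n > 0" "K + L \<le> c * \<alpha> * n" "n > 2 * L"
  shows "k \<le> card {v\<in>V. (1 - \<beta>) * n \<le> d v}"
proof -
  define A0 where "A0 = {v\<in>V. \<alpha> * n \<le> d v}"
  define A where "A = {v\<in>V. (1 - \<beta>) * n \<le> d v}"
  have fin: "finite A0" "finite A" using V(1) by (auto simp: A0_def A_def)
  have low: "(\<Sum>v\<in>V - X. d v ^ 2) \<le> t * n * (2 * c * n)"
    if "t \<ge> 0" "\<And>v. v \<in> V - X \<Longrightarrow> d v \<le> t * n" for X t
  proof -
    have "(\<Sum>v\<in>V - X. d v ^ 2) \<le> (\<Sum>v\<in>V - X. t * n * d v)"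
      unfolding power2_eq_square using that V by (intro sum_mono mult_right_mono) auto
    also have "\<dots> \<le> (\<Sum>v\<in>V. t * n * d v)"
      using V n that by (intro sum_mono2) auto
    also have "\<dots> = t * n * (\<Sum>v\<in>V. d v)" by (simp add: sum_distrib_left)
    also have "\<dots> \<le> t * n * (2 * c * n)" using sum n that by (intro mult_left_mono) auto
    finally show ?thesis .
  qed
  have split: "(\<Sum>v\<in>V. d v ^ 2) = (\<Sum>v\<in>V - X. d v ^ 2) + (\<Sum>v\<in>X. d v ^ 2)" if "X \<subseteq> V" for X
    using that V(1) by (rule sum.subset_diff)
  have "(\<Sum>v\<in>A0. d v * (n - d v)) = n * (\<Sum>v\<in>A0. d v) - (\<Sum>v\<in>A0. d v ^ 2)"
    by (simp add: right_diff_distrib sum_subtractf sum_distrib_left power2_eq_square mult_ac)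
  also have "\<dots> \<le> n * (real k * n + K) - (real k * n ^ 2 - L * n - \<alpha> * n * (2 * c * n))"
  proof -
    have "n * (\<Sum>v\<in>A0. d v) \<le> n * (real k * n + K)"
      using hi n by (intro mult_left_mono) (auto simp: A0_def)
    moreover have "(\<Sum>v\<in>V - A0. d v ^ 2) \<le> \<alpha> * n * (2 * c * n)"
      using \<alpha> by (intro low) (auto simp: A0_def)
    moreover have "A0 \<subseteq> V" by (auto simp: A0_def)
    ultimately show ?thesis using split[of A0] sq by linarith
  qed
  also have "\<dots> = (K + L) * n + 2 * c * \<alpha> * n ^ 2"
    by (simp add: algebra_simps power2_eq_square)
  also have "\<dots> \<le> (c * \<alpha> * n) * n + 2 * c * \<alpha> * n ^ 2"
    using n c \<alpha> by (intro add_mono mult_right_mono) auto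
  also have "\<dots> = 3 * c * \<alpha> * n ^ 2" by (simp add: power2_eq_square)
  finally have tot: "(\<Sum>v\<in>A0. d v * (n - d v)) \<le> 3 * c * \<alpha> * n ^ 2" .
  have small: "d v \<le> \<beta> * n" if v: "v \<in> V - A" for v
  proof (cases "v \<in> A0")
    case True
    then have "d v * (n - d v) \<le> (\<Sum>v\<in>A0. d v * (n - d v))"
      using V by (intro member_le_sum fin) (auto simp: A0_def)
    also note tot
    \<comment> \<open>\<open>\<beta>\<close> is chosen for this factorisation: the larger of
      \<open>d v\<close> and \<open>n - d v\<close> is at least \<open>n / 2\<close>, so the smaller
      is at most \<open>\<beta> * n\<close>.\<close>
    also have "3 * c * \<alpha> * n ^ 2 = (\<beta> * n) * (n / 2)" by (simp add: \<beta> power2_eq_square)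
    finally have one: "d v * (n - d v) \<le> (\<beta> * n) * (n / 2)" .
    have far: "n - d v > \<beta> * n" using v by (auto simp: A_def algebra_simps)
    have "d v \<le> n / 2"
    proof (rule ccontr)
      assume "\<not> d v \<le> n / 2"
      then have "(n / 2) * (\<beta> * n) < d v * (n - d v)"
        using far n \<alpha> c \<beta> by (intro mult_strict_mono) auto
      with one show False by (simp add: mult_ac)
    qed
    then have "d v * (n / 2) \<le> d v * (n - d v)"
      using V v by (intro mult_left_mono) auto
    with one have "d v * (n / 2) \<le> (\<beta> * n) * (n / 2)" by linarith
    then show ?thesis using n by (simp add: mult_le_cancel_right)
  next
    case False
    then have "d v \<le> \<alpha> * n" using v by (auto simp: A0_def)
    also have "\<dots> \<le> \<beta> * n" using c \<alpha> \<beta> n by (intro mult_right_mono) auto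
    finally show ?thesis .
  qed
  have b0: "\<beta> \<ge> 0" using \<beta> c \<alpha> by simp
  have "A \<subseteq> V" by (auto simp: A_def)
  have "(\<Sum>v\<in>A. d v ^ 2) \<le> (\<Sum>v\<in>A. n ^ 2)"
    using V by (intro sum_mono power_mono) (auto simp: A_def)
  moreover have "(\<Sum>v\<in>V - A. d v ^ 2) \<le> \<beta> * n * (2 * c * n)"
    using low[OF b0, of A] small by blast
  ultimately have "real k * n ^ 2 - L * n \<le> \<beta> * n * (2 * c * n) + real (card A) * n ^ 2"
    using split[OF \<open>A \<subseteq> V\<close>] sq by simp
  also have "\<beta> * n * (2 * c * n) = (2 * c * \<beta>) * n ^ 2" by (simp add: power2_eq_square)
  also have "\<dots> \<le> 1 / 2 * n ^ 2" using \<beta> by (intro mult_right_mono) auto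
  finally have "(real k - real (card A)) * n ^ 2 \<le> L * n + n ^ 2 / 2" by (simp add: algebra_simps)
  also have "\<dots> < 1 * n ^ 2"
  proof -
    have "2 * L * n < n * n" using n by (intro mult_strict_right_mono) auto
    then show ?thesis by (simp add: power2_eq_square)
  qed
  finally have "real k - real (card A) < 1" using n by (simp add: mult_less_cancel_right)
  then show ?thesis unfolding A_def by linarith
qed

text \<open>\<open>N\<close> depends on the parameters alone: as the degree sum is linear in
  \<open>n\<close>, the number of vertices of degree at least \<open>\<alpha> * n\<close> is bounded
  by a constant \<open>T\<close>. The precision \<open>B\<close> stays free because the closeness to
  full degree that is required is fixed only later.\<close>

lemma near_full_degree_vertices:
  fixes c k M r B :: nat
  assumes "r \<ge> 2" "c \<ge> 1" "B \<ge> 1"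
  shows "\<exists>N. \<forall>n\<ge>N. \<forall>G :: 'a graph. simple_graph G \<longrightarrow> card (verts G) = n \<longrightarrow>
    (\<Sum>v\<in>verts G. degree G v) \<le> 2 * c * n \<longrightarrow>
    (\<forall>S\<subseteq>verts G. card S = k + 1 \<longrightarrow> card (\<Inter>v\<in>S. nbr G v) < M) \<longrightarrow>
    k * (n - 1) ^ r \<le> e_r r G \<longrightarrow>
    (\<exists>A\<subseteq>verts G. card A = k \<and> (\<forall>a\<in>A. B * (n - degree G a) \<le> n))"
proof -
  \<comment> \<open>The summand \<open>real B\<close> gives \<open>B * \<beta> \<le> 1\<close>; the
    summand \<open>4 * real c\<close> gives the two upper bounds that the separation of degrees
    requires of \<open>\<beta>\<close>.\<close>
  define \<beta> where "\<beta> = 1 / (real B + 4 * real c)"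
  define \<alpha> where "\<alpha> = \<beta> / (6 * real c)"
  have pos: "\<alpha> > 0" "\<beta> > 0" using assms by (auto simp: \<alpha>_def \<beta>_def)
  define T where "T = nat \<lceil>2 * real c / \<alpha>\<rceil>"
  define K where "K = T * (2 ^ T * M)"
  define N where "N = nat \<lceil>(real K + real (k * r)) / (real c * \<alpha>)\<rceil> + 2 * (k * r) + 1"
  show ?thesis
  proof (intro exI[of _ N] allI impI)
    fix n and G :: "'a graph"
    assume n: "n \<ge> N" and G: "simple_graph G" "card (verts G) = n"
      and sum: "(\<Sum>v\<in>verts G. degree G v) \<le> 2 * c * n"
      and noK: "\<forall>S\<subseteq>verts G. card S = k + 1 \<longrightarrow> card (\<Inter>v\<in>S. nbr G v) < M"
      and e: "k * (n - 1) ^ r \<le> e_r r G"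
    have n1: "n \<ge> 1" using n by (simp add: N_def)
    note fV = finite_verts[OF G(1)]
    have deg: "degree G v \<le> n" if "v \<in> verts G" for v
      using degree_less[OF G(1) that] G by simp
    define A0 where "A0 = {v\<in>verts G. \<alpha> * real n \<le> real (degree G v)}"
    have sumr: "(\<Sum>v\<in>verts G. real (degree G v)) \<le> 2 * real c * real n"
      using sum by (metis of_nat_le_iff of_nat_mult of_nat_numeral of_nat_sum)
    have "real (card A0) * (\<alpha> * real n) = (\<Sum>v\<in>A0. \<alpha> * real n)" by simp
    also have "\<dots> \<le> (\<Sum>v\<in>A0. real (degree G v))" by (intro sum_mono) (auto simp: A0_def)
    also have "\<dots> \<le> (\<Sum>v\<in>verts G. real (degree G v))"
      using fV by (intro sum_mono2) (auto simp: A0_def)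
    also note sumr
    finally have "real (card A0) \<le> 2 * real c / \<alpha>" using n1 pos by (simp add: field_simps)
    then have T: "card A0 \<le> T" unfolding T_def by linarith
    have "(\<Sum>a\<in>A0. degree G a) \<le> k * n + card A0 * (2 ^ card A0 * M)"
      using sum_degree_bound_no_biclique[OF G(1), of A0 k M] noK G by (auto simp: A0_def)
    also have "\<dots> \<le> k * n + K" unfolding K_def
      using T by (intro add_mono mult_mono power_increasing) auto
    finally have hi: "(\<Sum>a\<in>A0. degree G a) \<le> k * n + K" .
    have "k \<le> card {v\<in>verts G. (1 - \<beta>) * real n \<le> real (degree G v)}"
    proof (rule many_near_full_degrees[where c = c and \<alpha> = \<alpha> and K = K and L = "real (k * r)"])
      show "(\<Sum>v\<in>{v \<in> verts G. \<alpha> * real n \<le> real (degree G v)}. real (degree G v)) \<le> real k * real n + real K"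
        using hi unfolding A0_def by (metis of_nat_add of_nat_le_iff of_nat_mult of_nat_sum)
      show "real k * real n ^ 2 - real (k * r) * real n \<le> (\<Sum>v\<in>verts G. real (degree G v) ^ 2)"
        using e deg n1 assms by (intro sum_squares_ge_of_sum_powers_ge) (auto simp: e_r_def)
      have "(real K + real (k * r)) / (real c * \<alpha>) \<le> real n" using n unfolding N_def by linarith
      then show "real K + real (k * r) \<le> real c * \<alpha> * real n"
        using pos assms by (simp add: field_simps)
      show "2 * real (k * r) < real n" using n unfolding N_def by linarith
      have "real B + 4 * real c \<ge> 4 * real c" "real c \<ge> 1" using assms by auto
      then show "\<beta> \<le> 1 / 2" "2 * real c * \<beta> \<le> 1 / 2" by (auto simp: \<beta>_def field_simps)
    qed (use fV deg assms pos sumr n1 in \<open>auto simp: \<alpha>_def\<close>)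
    then obtain A where A: "A \<subseteq> {v\<in>verts G. (1 - \<beta>) * real n \<le> real (degree G v)}" "card A = k"
      by (meson obtain_subset_with_card_n)
    have "B * (n - degree G a) \<le> n" if "a \<in> A" for a
    proof -
      have "real (n - degree G a) \<le> \<beta> * real n"
        using A that deg by (auto simp: of_nat_diff algebra_simps)
      then have "real B * real (n - degree G a) \<le> real B * (\<beta> * real n)" by (intro mult_left_mono) auto
      also have "\<dots> \<le> 1 * real n"
        unfolding mult.assoc[symmetric] using assms
        by (intro mult_right_mono) (auto simp: \<beta>_def field_simps)
      finally show ?thesis by (metis mult_1 of_nat_le_iff of_nat_mult)
    qed
    then show "\<exists>A\<subseteq>verts G. card A = k \<and> (\<forall>a\<in>A. B * (n - degree G a) \<le> n)"
      using A by blast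
  qed
qed

text \<open>The missing edges lower the power sum over \<open>A\<close> by at least
  \<open>q * (n - 1) ^ (r - 1)\<close>. As \<open>T\<close> has no edges leaving
  \<open>A \<union> T\<close>, its power sum is at most a constant times
  \<open>q * card T ^ (r - 1)\<close>, with \<open>card T\<close> small against \<open>n\<close>;
  this takes at most half of the loss, and the spare \<open>D ^ r\<close> less than the other half.
  The spare term is meant for \<open>F_graph n\<close> with \<open>n\<close> even, where one vertex
  falls short of degree \<open>D\<close>.\<close>

lemma e_r_less_of_deficiency:
  assumes G: "simple_graph G" and n: "card (verts G) = n" and "r \<ge> 2"
    and sparse: "\<And>S. S \<subseteq> verts G \<Longrightarrow> (\<Sum>v\<in>S. card (nbr G v \<inter> S)) \<le> 2 * c * card S"
    and A: "A \<subseteq> verts G" "card A = k"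
    and q: "q = (\<Sum>a\<in>A. n - 1 - degree G a)" "q \<ge> 1"
    and T: "T \<subseteq> verts G - A" "\<And>v. v \<in> T \<Longrightarrow> nbr G v \<subseteq> A \<union> T" "card T \<le> 4 * q"
    and D: "\<And>v. v \<in> verts G - A - T \<Longrightarrow> degree G v \<le> D"
    and big: "4 * q * (8 * (k + 1) ^ r * (2 * c + 1)) \<le> n - 1" "2 * D ^ r < n - 1"
  shows "e_r r G + D ^ r < k * (n - 1) ^ r + (n - k) * D ^ r"
proof -
  let ?V = "verts G" and ?t = "card T"
  note fV = finite_verts[OF G]
  have fin: "finite A" "finite T" using A T fV finite_subset by (blast, meson finite_Diff finite_subset)
  obtain m where m: "r = Suc m" "m \<ge> 1" using \<open>r \<ge> 2\<close> by (cases r) auto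
  \<comment> \<open>All but one of the \<open>r\<close> factors \<open>degree G a\<close> are
    replaced by \<open>n - 1\<close>, so each missing edge at \<open>a\<close> is charged
    \<open>(n - 1) ^ m\<close>.\<close>
  have "degree G a ^ r + (n - 1 - degree G a) * (n - 1) ^ m \<le> (n - 1) ^ r" if "a \<in> A" for a
  proof -
    have d: "degree G a \<le> n - 1" using degree_less[OF G, of a] that A n by auto
    have "degree G a ^ r + (n - 1 - degree G a) * (n - 1) ^ m
        \<le> degree G a * (n - 1) ^ m + (n - 1 - degree G a) * (n - 1) ^ m"
      using d by (simp add: m power_mono)
    also have "\<dots> = (degree G a + (n - 1 - degree G a)) * (n - 1) ^ m" by (simp only: add_mult_distrib)
    also have "\<dots> = (n - 1) ^ r" unfolding le_add_diff_inverse[OF d] m(1) by simp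
    finally show ?thesis .
  qed
  then have "(\<Sum>a\<in>A. degree G a ^ r + (n - 1 - degree G a) * (n - 1) ^ m) \<le> (\<Sum>a\<in>A. (n - 1) ^ r)"
    by (rule sum_mono)
  then have sA: "(\<Sum>a\<in>A. degree G a ^ r) + q * (n - 1) ^ m \<le> k * (n - 1) ^ r"
    using A q by (simp add: sum.distrib sum_distrib_right)
  have "(\<Sum>v\<in>?V - A - T. degree G v ^ r) \<le> (\<Sum>v\<in>?V - A - T. D ^ r)"
    using D by (intro sum_mono power_mono) auto
  also have "\<dots> \<le> (n - k) * D ^ r"
  proof -
    have "card (?V - A - T) \<le> card (?V - A)" using fV by (intro card_mono) auto
    also have "\<dots> = n - k" using fV A n fin by (simp add: card_Diff_subset)
    finally show ?thesis by simp
  qed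
  finally have sR: "(\<Sum>v\<in>?V - A - T. degree G v ^ r) \<le> (n - k) * D ^ r" .
  \<comment> \<open>One factor \<open>card (nbr G v \<inter> T)\<close> is kept, so that sparsity
    bounds its sum over \<open>T\<close> linearly in \<open>card T\<close>. Estimating it by
    \<open>card T\<close> as well would lose a factor \<open>card T\<close>.\<close>
  have "degree G v ^ r \<le> (k + 1) ^ r * (card (nbr G v \<inter> T) * ?t ^ m + 1)" if v: "v \<in> T" for v
  proof -
    let ?d = "card (nbr G v \<inter> T)"
    have "degree G v \<le> card (nbr G v \<inter> A) + ?d"
      unfolding degree_eq_card_nbr[OF G] using T(2)[OF v] card_Un_le
      by (metis Int_Un_distrib inf.absorb_iff1)
    also have "\<dots> \<le> k + ?d" using card_mono[OF fin(1), of "nbr G v \<inter> A"] A by simp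
    finally have d: "degree G v \<le> k + ?d" .
    have t: "?d \<le> ?t" using fin by (intro card_mono) auto
    show ?thesis
    proof (cases "?d = 0")
      case True
      then have "degree G v ^ r \<le> (k + 1) ^ r" using d by (intro power_mono) auto
      then show ?thesis using True by simp
    next
      case False
      then have "k * 1 \<le> k * ?d" by (intro mult_le_mono2) simp
      then have "k + ?d \<le> (k + 1) * ?d" by simp
      with d have "degree G v ^ r \<le> ((k + 1) * ?d) ^ r" by (intro power_mono) linarith+
      also have "\<dots> = (k + 1) ^ r * (?d * ?d ^ m)" by (simp only: m power_mult_distrib power_Suc mult_ac)
      also have "\<dots> \<le> (k + 1) ^ r * (?d * ?t ^ m)" using t by (intro mult_le_mono2 power_mono) auto
      finally show ?thesis by (simp add: algebra_simps)
    qed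
  qed
  then have "(\<Sum>v\<in>T. degree G v ^ r) \<le> (\<Sum>v\<in>T. (k + 1) ^ r * (card (nbr G v \<inter> T) * ?t ^ m + 1))"
    by (rule sum_mono)
  also have "\<dots> = (k + 1) ^ r * ((\<Sum>v\<in>T. card (nbr G v \<inter> T)) * ?t ^ m + ?t)"
    by (simp only: sum_distrib_left[symmetric] sum.distrib sum_distrib_right[symmetric]) simp
  also have "\<dots> \<le> (k + 1) ^ r * (2 * c * ?t * ?t ^ m + ?t * ?t ^ m)"
  proof -
    have "?t \<le> ?t * ?t ^ m" by (cases "?t = 0") auto
    then show ?thesis using sparse[of T] T by (intro mult_le_mono2 add_mono mult_le_mono1) auto
  qed
  also have "\<dots> = (k + 1) ^ r * (2 * c + 1) * (?t * ?t ^ m)" by (simp add: algebra_simps)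
  also have "\<dots> \<le> (k + 1) ^ r * (2 * c + 1) * (4 * q * ?t ^ m)"
    using T by (intro mult_le_mono2 mult_le_mono1)
  finally have "2 * (\<Sum>v\<in>T. degree G v ^ r) \<le> q * ((8 * (k + 1) ^ r * (2 * c + 1)) * ?t ^ m)"
    by (simp add: algebra_simps)
  also have "\<dots> \<le> q * (n - 1) ^ m"
  proof (rule mult_le_mono2)
    let ?b = "8 * (k + 1) ^ r * (2 * c + 1)"
    \<comment> \<open>As \<open>m \<ge> 1\<close>, the constant may be moved under the power and
      absorbed by \<open>n - 1\<close>. Its 8 is the 4 of \<open>card T \<le> 4 * q\<close>, doubled
      because only half of the loss may be used.\<close>
    have "?b * ?t ^ m \<le> ?b ^ m * ?t ^ m"
      using m by (intro mult_le_mono1 self_le_power) (simp_all del: power_Suc add: Suc_le_eq)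
    also have "\<dots> = (?t * ?b) ^ m" by (simp add: power_mult_distrib mult.commute)
    also have "\<dots> \<le> (n - 1) ^ m"
      using T(3) big(1) by (intro power_mono) (meson le_trans mult_le_mono1, simp)
    finally show "?b * ?t ^ m \<le> (n - 1) ^ m" .
  qed
  finally have sT: "2 * (\<Sum>v\<in>T. degree G v ^ r) \<le> q * (n - 1) ^ m" .
  have "2 * D ^ r < (n - 1) ^ m" using big(2) m self_le_power[of "n - 1" m]
    by (metis One_nat_def Suc_le_eq bot_nat_0.not_eq_extremum less_le_trans not_less_zero)
  also have "\<dots> \<le> q * (n - 1) ^ m" using q by simp
  finally have sD: "2 * D ^ r < q * (n - 1) ^ m" .
  have "e_r r G = (\<Sum>v\<in>?V - A. degree G v ^ r) + (\<Sum>v\<in>A. degree G v ^ r)"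
    unfolding e_r_def using A(1) fV by (rule sum.subset_diff)
  also have "(\<Sum>v\<in>?V - A. degree G v ^ r) = (\<Sum>v\<in>?V - A - T. degree G v ^ r) + (\<Sum>v\<in>T. degree G v ^ r)"
    using T(1) fV by (intro sum.subset_diff) auto
  finally show ?thesis using sA sR sT sD by linarith
qed

text \<open>Taking from \<open>ws\<close> before \<open>as\<close> puts an element of
  \<open>as\<close> second, where the brush is attached, and another last, where a tail can follow.
  The lists will be common neighbours and vertices of \<open>A\<close>, of equal length.\<close>

fun interleave :: "'a list \<Rightarrow> 'a list \<Rightarrow> 'a list" where
  "interleave (w # ws) (a # as) = w # a # interleave ws as"
| "interleave _ _ = []"

lemma interleave_props:
  assumes "length ws = length as"
  shows "length (interleave ws as) = 2 * length as"
    and "set (interleave ws as) = set ws \<union> set as"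
    and "as \<noteq> [] \<Longrightarrow> hd (interleave ws as) = hd ws"
    and "as \<noteq> [] \<Longrightarrow> last (interleave ws as) = last as"
    and "as \<noteq> [] \<Longrightarrow> interleave ws as ! 1 = hd as"
    and "(interleave ws as = []) = (as = [])"
  using assms by (induction ws as rule: list_induct2) (auto simp: hd_conv_nth split: if_splits)

lemma distinct_interleave:
  assumes "length ws = length as" "distinct ws" "distinct as" "set ws \<inter> set as = {}"
  shows "distinct (interleave ws as)"
  using assms by (induction ws as rule: list_induct2) (auto simp: interleave_props)

lemma walk_interleave:
  assumes "length ws = length as" "\<And>w a. w \<in> set ws \<Longrightarrow> a \<in> set as \<Longrightarrow> w \<in> nbr G a"
  shows "walk G (interleave ws as)"
  using assms
proof (induction ws as rule: list_induct2)
  case (Cons w ws a as)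
  then have IH: "walk G (interleave ws as)" by simp
  have "a \<in> nbr G w" using Cons.prems nbr_sym by fastforce
  moreover have "hd (interleave ws as) \<in> nbr G a" if "interleave ws as \<noteq> []"
    using that Cons.hyps Cons.prems by (cases ws; cases as) auto
  ultimately show ?case using IH by (auto simp: walk_def successively_Cons)
qed (simp add: walk_def)

lemma walk_append:
  assumes "walk G p" "walk G p'" "p \<noteq> [] \<Longrightarrow> p' \<noteq> [] \<Longrightarrow> hd p' \<in> nbr G (last p)"
  shows "walk G (p @ p')"
  using assms by (auto simp: walk_def successively_append_iff)

lemma obtain_list_avoiding:
  assumes "finite W" "finite X" "card X + m \<le> card W"
  obtains ws where "distinct ws" "length ws = m" "set ws \<subseteq> W - X"
proof -
  have "m \<le> card (W - X)" using assms diff_card_le_card_Diff[of X W] by linarith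
  then obtain S where "S \<subseteq> W - X" "card S = m" by (meson obtain_subset_with_card_n)
  moreover then have "finite S" using assms finite_subset by blast
  ultimately show thesis using that finite_distinct_list by (metis distinct_card)
qed

lemma obtain_list_with_last:
  assumes "finite A" "a \<in> A"
  obtains as where "distinct as" "set as = A" "last as = a" "length as = card A" "as \<noteq> []"
proof -
  obtain xs where xs: "set xs = A - {a}" "distinct xs" using assms finite_distinct_list by (metis finite_Diff)
  have "distinct (xs @ [a])" "set (xs @ [a]) = A" using xs assms by auto
  then show thesis using that[of "xs @ [a]"] distinct_card by fastforce
qed

subsection \<open>Brooms along alternating paths\<close>

text \<open>Every vertex of \<open>W\<close> is adjacent to every vertex of \<open>A\<close>, so
  \<open>A\<close> may be traversed in any order, in particular ending in the neighbour
  \<open>a\<close> of the first vertex of \<open>t\<close>. The vertices used from \<open>W\<close>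
  are chosen off \<open>t\<close>.\<close>

lemma contains_broom_of_alternating_path:
  assumes G: "simple_graph G" and A: "A \<subseteq> verts G" "a \<in> A"
    and W: "W \<subseteq> verts G" "\<And>a. a \<in> A \<Longrightarrow> W \<subseteq> nbr G a" "card A + length t \<le> card W"
    and deg: "\<And>a. a \<in> A \<Longrightarrow> s + (2 * card A + length t) \<le> degree G a"
    and t: "walk G t" "distinct t" "set t \<subseteq> verts G - A" "t \<noteq> [] \<Longrightarrow> hd t \<in> nbr G a"
  shows "contains G (broom (2 * card A + length t) s)"
proof -
  have fin: "finite A" "finite W" using A W finite_verts[OF G] finite_subset by blast+
  obtain as where as: "distinct as" "set as = A" "last as = a" "length as = card A" "as \<noteq> []"
    using obtain_list_with_last[OF fin(1) A(2)] by metis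
  have "card (set t) + card A \<le> card W" using W(3) t(2) by (simp add: distinct_card)
  then obtain ws where ws: "distinct ws" "length ws = card A" "set ws \<subseteq> W - set t"
    using obtain_list_avoiding[OF fin(2), of "set t"] by (metis List.finite_set)
  have disj: "set ws \<inter> set as = {}"
    using ws(3) W(2) as(2) nbr_subset[OF G] by fastforce
  let ?p = "interleave ws as"
  have len: "length ws = length as" using ws as by simp
  note p = interleave_props[OF len]
  have "1 < length ?p" using p(1) as(5) by (cases as) auto
  then have nth: "(?p @ t) ! 1 \<in> A"
    using p(5) as(2,5) hd_in_set[of as] by (simp add: nth_append)
  show ?thesis
  proof (rule contains_broom_of_path[OF G])
    have "walk G ?p" using W(2) ws(3) as(2) by (intro walk_interleave[OF len]) blast
    then show "walk G (?p @ t)" using t p as by (intro walk_append) auto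
    show "distinct (?p @ t)"
      using distinct_interleave[OF len ws(1) as(1) disj] t ws p(2) as(2) by auto
    show "set (?p @ t) \<subseteq> verts G" using p(2) as ws t W A by auto
    show "length (?p @ t) = 2 * card A + length t" using p(1) as by simp
    show "2 \<le> 2 * card A + length t" using as by (cases as) auto
    show "s + (2 * card A + length t) \<le> degree G ((?p @ t) ! 1) \<or> s = 0" using deg[OF nth] by simp
  qed
qed

text \<open>Through the \<open>k + 1\<close> vertices of \<open>S\<close> the alternating path
  already has \<open>2 * k + 2\<close> vertices; for odd \<open>l\<close> one more common neighbour
  is appended.\<close>

lemma broom_free_no_biclique:
  assumes G: "simple_graph G" and free: "\<not> contains G (broom l s)"
    and l: "l = 2 * k + 2 \<or> l = 2 * k + 3" and S: "S \<subseteq> verts G" "card S = k + 1"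
  shows "card (\<Inter>v\<in>S. nbr G v) < s + l + k + 2"
proof (rule ccontr)
  let ?W = "\<Inter>v\<in>S. nbr G v"
  assume "\<not> ?thesis"
  then have W: "s + l + k + 2 \<le> card ?W" by simp
  obtain a where a: "a \<in> S" using S by fastforce
  have sub: "?W \<subseteq> nbr G a" if "a \<in> S" for a using that by blast
  have deg: "card ?W \<le> degree G a" if "a \<in> S" for a
    unfolding degree_eq_card_nbr[OF G] using sub[OF that] finite_nbr[OF G] by (rule card_mono[rotated])
  have Wv: "?W \<subseteq> verts G" using sub[OF a] nbr_subset[OF G] by blast
  have "?W \<noteq> {}" using W by (metis card.empty le_zero_eq add_is_0 zero_neq_numeral)
  then obtain w where w: "w \<in> ?W" by blast
  then have "w \<notin> S" using nbr_subset[OF G] by fastforce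
  have "contains G (broom (2 * card S + length (if l = 2 * k + 2 then [] else [w])) s)"
  proof (rule contains_broom_of_alternating_path[OF G S(1) a, of ?W])
    show "s + (2 * card S + length (if l = 2 * k + 2 then [] else [w])) \<le> degree G a" if "a \<in> S" for a
      using deg[OF that] W S(2) l by (auto split: if_splits)
  qed (use W S l w sub Wv \<open>w \<notin> S\<close> a in \<open>auto simp: walk_def\<close>)
  then show False using l free S(2) by (auto split: if_splits simp: numeral_3_eq_3)
qed

text \<open>For a simple graph and \<open>A\<close> inside its vertex set, this counts the non-edges
  meeting \<open>A\<close>, those inside \<open>A\<close> from both ends. No degree exceeds
  \<open>card (verts G) - 1\<close>, so the subtraction does not truncate.\<close>

abbreviation deficiency :: "'a graph \<Rightarrow> 'a set \<Rightarrow> nat" where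
  "deficiency G A \<equiv> (\<Sum>a\<in>A. card (verts G) - 1 - degree G a)"

lemma card_not_common_nbr_le:
  assumes G: "simple_graph G" and A: "A \<subseteq> verts G"
  shows "card (verts G - A - {w \<in> verts G - A. A \<subseteq> nbr G w})
    \<le> deficiency G A" (is "card ?X \<le> _")
proof -
  let ?V = "verts G"
  note finV = finite_verts[OF G]
  have finA: "finite A" using A finV finite_subset by blast
  have "?X \<subseteq> (\<Union>a\<in>A. ?V - {a} - nbr G a)"
    by (auto simp: nbr_sym)
  then have "card ?X \<le> card (\<Union>a\<in>A. ?V - {a} - nbr G a)"
    using finV finA by (intro card_mono) auto
  also have "\<dots> \<le> (\<Sum>a\<in>A. card (?V - {a} - nbr G a))"
    by (rule card_UN_le[OF finA])
  also have "\<dots> = (\<Sum>a\<in>A. card ?V - 1 - degree G a)"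
  proof (rule sum.cong)
    fix a assume "a \<in> A"
    then show "card (?V - {a} - nbr G a) = card ?V - 1 - degree G a"
      using A finV finite_nbr[OF G] nbr_subset[OF G, of a]
      by (subst card_Diff_subset) (auto simp: degree_eq_card_nbr[OF G])
  qed simp
  finally show ?thesis .
qed

text \<open>The size of \<open>W\<close> leaves room for alternating paths that avoid the few
  vertices of the given edges. The degree bound leaves \<open>s\<close> brush vertices off a path on
  \<open>2 * k + 3\<close> vertices.\<close>

locale near_full =
  fixes G :: "'a graph" and A W :: "'a set" and k s :: nat
  assumes G: "simple_graph G" and A: "A \<subseteq> verts G" "card A = k" "k \<ge> 1"
    and W: "W = {w \<in> verts G - A. A \<subseteq> nbr G w}" "k + 5 \<le> card W"
    and deg: "\<And>a. a \<in> A \<Longrightarrow> s + (2 * k + 3) \<le> degree G a"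
begin

lemma W_sub: "W \<subseteq> verts G" "a \<in> A \<Longrightarrow> W \<subseteq> nbr G a"
  using W by (auto simp: nbr_sym)

lemma finA: "finite A" and finW: "finite W"
  using A W_sub finite_verts[OF G] finite_subset by blast+

text \<open>The edge is the tail of an alternating path that ends in \<open>a\<close>.\<close>

lemma edge_at_A_nbr:
  assumes "u \<in> verts G - A" "v \<in> verts G - A" "v \<in> nbr G u" "a \<in> A" "u \<in> nbr G a"
  shows "contains G (broom (2 * k + 2) s)"
proof -
  have "u \<noteq> v" using assms nbr_in_verts[OF G] by blast
  have "contains G (broom (2 * card A + length [u, v]) s)"
    by (rule contains_broom_of_alternating_path[OF G A(1) \<open>a \<in> A\<close>, of W])
      (use assms A W W_sub deg \<open>u \<noteq> v\<close> in \<open>force simp: walk_def\<close>)+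
  then show ?thesis using A by simp
qed

lemma path_at_A_nbr:
  assumes "y \<in> verts G - A" "v \<in> verts G - A" "t \<in> verts G - A" "v \<in> nbr G y" "t \<in> nbr G v"
    "y \<noteq> t" "a \<in> A" "y \<in> nbr G a"
  shows "contains G (broom (2 * k + 3) s)"
proof -
  have "y \<noteq> v" "v \<noteq> t" using assms nbr_in_verts[OF G] by blast+
  have "contains G (broom (2 * card A + length [y, v, t]) s)"
    by (rule contains_broom_of_alternating_path[OF G A(1) \<open>a \<in> A\<close>, of W])
      (use assms A W W_sub deg \<open>y \<noteq> v\<close> \<open>v \<noteq> t\<close> in \<open>force simp: walk_def\<close>)+
  then show ?thesis using A by (simp add: numeral_3_eq_3)
qed

text \<open>The edge \<open>u, v\<close> links two vertices of \<open>A\<close> in place of one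
  common neighbour, so the path \<open>x, b, u, v, ..., a, u', v'\<close> is one vertex longer than
  without the splice. The brush sits at \<open>b \<noteq> a\<close>, which takes
  \<open>k \<ge> 2\<close>; for \<open>k = 1\<close> there remains the path
  \<open>v, u, a, u', v'\<close>, used with an empty brush.\<close>

lemma two_edges:
  assumes uv: "u \<in> W" "v \<in> W" "v \<in> nbr G u"
    and uv': "u' \<in> verts G - A" "v' \<in> verts G - A" "v' \<in> nbr G u'" "{u, v} \<inter> {u', v'} = {}"
    and a: "a \<in> A" "u' \<in> nbr G a" and ks: "k \<ge> 2 \<or> s = 0"
  shows "contains G (broom (2 * k + 3) s)"
proof (cases "k \<ge> 2")
  case False
  then have k: "k = 1" "s = 0" using A ks by auto
  have ne: "u \<noteq> v" "u' \<noteq> v'" using uv uv' nbr_in_verts[OF G] by blast+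
  have sub: "u \<in> verts G - A" "v \<in> verts G - A" using uv W by auto
  have "walk G [v, u, a, u', v']" using uv uv' a W_sub by (auto simp: walk_def nbr_sym W(1))
  then have "contains G (broom 5 s)"
    by (rule contains_broom_of_path[OF G]) (use ne sub uv' a A k in auto)
  then show ?thesis using k by simp
next
  case True
  have ne: "u \<noteq> v" "u' \<noteq> v'" using uv uv' nbr_in_verts[OF G] by blast+
  have sub: "u \<in> verts G - A" "v \<in> verts G - A" using uv W by auto
  obtain b where b: "b \<in> A" "b \<noteq> a"
    using True A(2) a finA by (metis card_le_Suc0_iff_eq not_less_eq_eq numeral_2_eq_2)
  obtain as where as: "distinct as" "set as = A - {b}" "last as = a" "length as = card (A - {b})" "as \<noteq> []"
    using obtain_list_with_last[of "A - {b}" a] finA a b by (metis finite_Diff insertE insert_Diff)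
  have la: "length as = k - 1" using as b A finA by simp
  have "card {u, v, u', v'} \<le> 4" using card_insert_le_m1 by (simp add: card_insert_if)
  then have "card {u, v, u', v'} + (k - 1) \<le> card W" using W by linarith
  then obtain zs where zs: "distinct zs" "length zs = k - 1" "set zs \<subseteq> W - {u, v, u', v'}"
    using obtain_list_avoiding[OF finW, of "{u, v, u', v'}"] by (metis finite.emptyI finite.insertI)
  obtain x ws where x: "zs = x # ws" using zs True by (cases zs) auto
  have len: "length (v # ws) = length as" using zs x la by simp
  have vws: "set (v # ws) \<subseteq> W" using zs x uv by auto
  have WA: "W \<inter> A = {}" using W by auto
  let ?p = "interleave (v # ws) as"
  note p = interleave_props[OF len]
  \<comment> \<open>The alternating part covers \<open>A - {b}\<close> and starts at
    \<open>v\<close>, so the length is \<open>3 + 2 * (k - 1) + 2\<close>.\<close>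
  let ?P = "[x, b, u] @ (?p @ [u', v'])"
  have "contains G (broom (2 * k + 3) s)"
  proof (rule contains_broom_of_path[OF G])
    have "walk G ?p" using vws W_sub as(2) by (intro walk_interleave[OF len]) blast
    moreover have "walk G [u', v']" using uv' by (simp add: walk_def)
    ultimately have "walk G (?p @ [u', v'])"
      using p as a by (intro walk_append) auto
    moreover have "walk G [x, b, u]"
      using b x zs uv W_sub by (auto simp: walk_def W(1) nbr_sym)
    moreover have "hd (?p @ [u', v']) \<in> nbr G (last [x, b, u])"
      using p(3,6) as(5) uv by simp
    ultimately show "walk G ?P" using walk_append by blast
    have "distinct ?p"
      using zs x as vws WA by (intro distinct_interleave[OF len]) auto
    then show "distinct ?P"
      using p(2) as zs x ne sub uv uv' b WA by auto
    show "set ?P \<subseteq> verts G" using p(2) as zs x sub uv' b A W_sub by auto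
    show "length ?P = 2 * k + 3" using p(1) la True by simp
    show "s + (2 * k + 3) \<le> degree G (?P ! 1) \<or> s = 0" using deg[OF b(1)] by simp
  qed simp
  then show ?thesis .
qed

end

subsection \<open>The extremal graphs\<close>

text \<open>\<open>G\<close> is a spanning subgraph of \<open>H\<close> up to renaming, so degrees
  are dominated. Since the power sum of \<open>G\<close> is not smaller, all degrees agree and no
  edge of \<open>H\<close> is missing.\<close>

lemma isomorphic_of_embedding:
  fixes G :: "'a graph" and H :: "'b graph"
  assumes G: "simple_graph G" and H: "simple_graph H" and g: "bij_betw g (verts H) (verts G)"
    and emb: "\<And>i j. i \<in> verts H \<Longrightarrow> j \<in> verts H \<Longrightarrow> g j \<in> nbr G (g i) \<Longrightarrow> j \<in> nbr H i"
    and r: "r \<ge> 1" and le: "e_r r H \<le> e_r r G"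
  shows "isomorphic G H \<and> e_r r G = e_r r H"
proof -
  have inj: "inj_on g (verts H)" using g by (simp add: bij_betw_def)
  have sub: "nbr G (g i) \<subseteq> g ` nbr H i" if i: "i \<in> verts H" for i
  proof
    fix y assume y: "y \<in> nbr G (g i)"
    then have "y \<in> verts G" using nbr_in_verts[OF G] by blast
    then obtain j where "j \<in> verts H" "y = g j" using g by (auto simp: bij_betw_def)
    then show "y \<in> g ` nbr H i" using emb i y by blast
  qed
  have card_img: "card (g ` nbr H i) = card (nbr H i)" for i
    using inj nbr_subset[OF H] by (intro card_image) (meson Diff_subset inj_on_subset order_trans)
  have deg: "degree G (g i) \<le> degree H i" if "i \<in> verts H" for i
    unfolding degree_eq_card_nbr[OF G] degree_eq_card_nbr[OF H]
    using card_mono[OF _ sub[OF that]] finite_nbr[OF H] card_img by force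
  have eG: "e_r r G = (\<Sum>i\<in>verts H. degree G (g i) ^ r)"
    unfolding e_r_def by (rule sum.reindex_bij_betw[OF g, symmetric])
  have "e_r r G \<le> e_r r H"
    unfolding eG unfolding e_r_def by (intro sum_mono power_mono deg) auto
  with le have eq: "e_r r G = e_r r H" by simp
  have "degree G (g i) = degree H i" if i: "i \<in> verts H" for i
  proof -
    have "(\<Sum>i\<in>verts H. degree G (g i) ^ r) = (\<Sum>i\<in>verts H. degree H i ^ r)"
      using eq eG by (simp add: e_r_def)
    then have "degree G (g i) ^ r = degree H i ^ r"
      by (rule sum_mono_inv) (use i deg finite_verts[OF H] in \<open>simp_all add: power_mono\<close>)
    then show ?thesis using r by (simp add: power_eq_iff_eq_base)
  qed
  then have img: "nbr G (g i) = g ` nbr H i" if "i \<in> verts H" for i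
    using that sub[OF that] card_img finite_nbr[OF H]
    by (intro card_subset_eq) (auto simp: degree_eq_card_nbr[OF G] degree_eq_card_nbr[OF H])
  let ?f = "inv_into (verts H) g"
  have "isomorphic G H"
    unfolding isomorphic_def
  proof (intro exI conjI ballI)
    show "bij_betw ?f (verts G) (verts H)" using g by (rule bij_betw_inv_into)
    fix u v assume "u \<in> verts G" "v \<in> verts G"
    then obtain i j where ij: "i \<in> verts H" "j \<in> verts H" "u = g i" "v = g j"
      using g unfolding bij_betw_def by blast
    have "v \<in> nbr G u \<longleftrightarrow> j \<in> nbr H i"
      using ij img[of i] inj nbr_subset[OF H, of i] by (auto dest: inj_onD)
    then show "{u, v} \<in> edges G \<longleftrightarrow> {?f u, ?f v} \<in> edges H"
      using ij inj by (simp add: nbr_def)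
  qed
  with eq show ?thesis by simp
qed

lemma isomorphic_of_list_embedding:
  fixes G :: "'a graph" and H :: "nat graph"
  assumes "simple_graph G" "simple_graph H" "verts H = {0..<n}" "card (verts G) = n"
    and xs: "distinct xs" "set xs = verts G"
    and emb: "\<And>i j. i < j \<Longrightarrow> j < n \<Longrightarrow> xs ! j \<in> nbr G (xs ! i) \<Longrightarrow> j \<in> nbr H i"
    and "r \<ge> 1" "e_r r H \<le> e_r r G"
  shows "isomorphic G H \<and> e_r r G = e_r r H"
proof (rule isomorphic_of_embedding[where g = "nth xs"])
  have len: "length xs = n" using assms distinct_card by fastforce
  then show "bij_betw ((!) xs) (verts H) (verts G)"
    using assms by (intro bij_betw_nth) auto
  fix i j assume ij: "i \<in> verts H" "j \<in> verts H" "xs ! j \<in> nbr G (xs ! i)"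
  have "xs ! i \<noteq> xs ! j" using nbr_in_verts[OF assms(1) ij(3)] by auto
  then have "i < j \<or> j < i" by (metis linorder_neqE_nat)
  then show "j \<in> nbr H i"
    using emb[of i j] emb[of j i] ij assms(3) by (auto simp: nbr_sym)
qed (use assms in auto)

lemma finite_broom_free: "finite {G. nvertex_graph n G \<and> \<not> contains G F}"
proof (rule finite_subset)
  show "{G. nvertex_graph n G \<and> \<not> contains G F} \<subseteq> {{0..<n}} \<times> Pow (Pow {0..<n})"
    by (auto simp: nvertex_graph_def simple_graph_def verts_def edges_def)
qed auto

text \<open>One comparison gives maximum, extremality and uniqueness: a competitor at least as good
  as \<open>T\<close> already is \<open>T\<close> up to isomorphism.\<close>

lemma extremalI:
  assumes T: "nvertex_graph n T" "\<not> contains T F"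
    and max: "\<And>G. nvertex_graph n G \<Longrightarrow> \<not> contains G F \<Longrightarrow> e_r r T \<le> e_r r G \<Longrightarrow>
      isomorphic G T \<and> e_r r G = e_r r T"
  shows "ex_r r n F = e_r r T \<and> extremal r n F T \<and> (\<forall>G. extremal r n F G \<longrightarrow> isomorphic G T)"
proof -
  let ?S = "{G. nvertex_graph n G \<and> \<not> contains G F}"
  have "ex_r r n F = e_r r T"
    unfolding ex_r_def
  proof (rule Max_eqI)
    fix y assume "y \<in> e_r r ` ?S"
    then obtain G where "nvertex_graph n G" "\<not> contains G F" "y = e_r r G" by blast
    then show "y \<le> e_r r T" using max[of G] by linarith
  qed (use T finite_broom_free in blast)+
  then show ?thesis using T max by (simp add: extremal_def)
qed

section \<open>The target graphs: neighbourhoods and lower bounds for their degree power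
  sums\<close>

lemma nbr_H_graph: "nbr (H_graph k n) i = {j. i < n \<and> j < n \<and> i \<noteq> j \<and> (i < k \<or> j < k)}"
  by (auto simp: nbr_def H_graph_def edges_def doubleton_eq_iff)

lemma nbr_H_star:
  "nbr (H_star k n) i = nbr (H_graph k n) i \<union> {j. {i, j} = {k, k + 1}}"
  by (auto simp: nbr_def H_star_def edges_def)

text \<open>The floor in the number of matching edges becomes the guard \<open>< n\<close>: for even
  positive \<open>n\<close> the odd vertex \<open>n - 1\<close> has no partner.\<close>

lemma nbr_F_graph:
  "j \<in> nbr (F_graph n) i \<longleftrightarrow> (i = 0 \<and> 1 \<le> j \<and> j < n) \<or> (j = 0 \<and> 1 \<le> i \<and> i < n) \<or>
    (odd i \<and> j = i + 1 \<and> j < n) \<or> (odd j \<and> i = j + 1 \<and> i < n)"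
proof -
  have *: "(\<exists>t. {i, j} = {2 * t - 1, 2 * t} \<and> 1 \<le> t \<and> t \<le> (n - 1) div 2) \<longleftrightarrow>
    (odd i \<and> j = i + 1 \<and> j < n) \<or> (odd j \<and> i = j + 1 \<and> i < n)" (is "?L \<longleftrightarrow> ?R")
  proof
    assume ?L
    then obtain t where t: "{i, j} = {2 * t - 1, 2 * t}" "1 \<le> t" "t \<le> (n - 1) div 2" by blast
    have "2 * t < n" "odd (2 * t - 1)" using t by auto
    with t show ?R by (auto simp: doubleton_eq_iff)
  next
    assume ?R
    then show ?L
    proof
      assume h: "odd i \<and> j = i + 1 \<and> j < n"
      then obtain t where "i = 2 * t + 1" by (metis oddE)
      with h show ?L by (intro exI[of _ "t + 1"]) auto
    next
      assume h: "odd j \<and> i = j + 1 \<and> i < n"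
      then obtain t where "j = 2 * t + 1" by (metis oddE)
      with h show ?L by (intro exI[of _ "t + 1"]) auto
    qed
  qed
  have "j \<in> nbr (F_graph n) i \<longleftrightarrow> (\<exists>v. {i, j} = {0, v} \<and> 1 \<le> v \<and> v < n) \<or>
      (\<exists>t. {i, j} = {2 * t - 1, 2 * t} \<and> 1 \<le> t \<and> t \<le> (n - 1) div 2)"
    by (simp add: nbr_def F_graph_def edges_def)
  then show ?thesis unfolding * by (auto simp: doubleton_eq_iff)
qed

lemma nvertex_H_graph: "nvertex_graph n (H_graph k n)"
  by (auto simp: nvertex_graph_def simple_graph_def H_graph_def verts_def edges_def)

lemma nvertex_H_star:
  assumes "k + 1 < n" shows "nvertex_graph n (H_star k n)"
proof -
  have "\<exists>u<n. \<exists>v<n. u \<noteq> v \<and> {k, Suc k} = {u, v}" using assms by (intro exI[of _ k]) auto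
  then show ?thesis using nvertex_H_graph[of n k]
    by (auto simp: nvertex_graph_def simple_graph_def H_star_def verts_def edges_def)
qed

lemma nvertex_F_graph: "nvertex_graph n (F_graph n)"
proof -
  have "\<exists>u<n. \<exists>v<n. u \<noteq> v \<and> {2 * i - Suc 0, 2 * i} = {u, v}" if "Suc 0 \<le> i" "i \<le> (n - Suc 0) div 2" for i
    using that by (intro exI[of _ "2 * i - 1"] conjI exI[of _ "2 * i"]) auto
  moreover have "\<exists>u<n. \<exists>w<n. u \<noteq> w \<and> {0, v} = {u, w}" if "Suc 0 \<le> v" "v < n" for v
    using that by (intro exI[of _ 0] conjI exI[of _ v]) auto
  ultimately show ?thesis
    by (auto simp: nvertex_graph_def simple_graph_def F_graph_def verts_def edges_def)
qed

text \<open>The bound \<open>m\<close> allows final vertices to be ignored; \<open>F_graph n\<close>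
  is treated with \<open>m = n - 1\<close>, since its last vertex may be unmatched.\<close>

lemma e_r_ge_of_degrees:
  assumes T: "nvertex_graph n T" and "k \<le> n"
    and hi: "\<And>v. v < k \<Longrightarrow> n - 1 \<le> card (nbr T v)"
    and lo: "\<And>v. k \<le> v \<Longrightarrow> v < m \<Longrightarrow> d \<le> card (nbr T v)" and "m \<le> n"
  shows "k * (n - 1) ^ r + (m - k) * d ^ r \<le> e_r r T"
proof -
  have G: "simple_graph T" "verts T = {0..<n}" using T by (auto simp: nvertex_graph_def)
  have "k * (n - 1) ^ r = (\<Sum>v\<in>{0..<k}. (n - 1) ^ r)" by simp
  also have "\<dots> \<le> (\<Sum>v\<in>{0..<k}. degree T v ^ r)"
    using hi by (intro sum_mono power_mono) (auto simp: degree_eq_card_nbr[OF G(1)])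
  finally have 1: "k * (n - 1) ^ r \<le> (\<Sum>v\<in>{0..<k}. degree T v ^ r)" .
  have "(m - k) * d ^ r = (\<Sum>v\<in>{k..<m}. d ^ r)" by simp
  also have "\<dots> \<le> (\<Sum>v\<in>{k..<m}. degree T v ^ r)"
    using lo by (intro sum_mono power_mono) (auto simp: degree_eq_card_nbr[OF G(1)])
  also have "\<dots> \<le> (\<Sum>v\<in>{k..<n}. degree T v ^ r)"
    using \<open>m \<le> n\<close> by (intro sum_mono2) auto
  finally have 2: "(m - k) * d ^ r \<le> (\<Sum>v\<in>{k..<n}. degree T v ^ r)" .
  have "e_r r T = (\<Sum>v\<in>{0..<k}. degree T v ^ r) + (\<Sum>v\<in>{k..<n}. degree T v ^ r)"
    unfolding e_r_def G using \<open>k \<le> n\<close> by (simp add: sum.atLeastLessThan_concat)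
  with 1 2 show ?thesis by simp
qed

lemma card_nbr_ge:
  assumes "nvertex_graph n T" "X \<subseteq> nbr T v" "card X = d" shows "d \<le> card (nbr T v)"
  using card_mono[of "nbr T v" X] finite_nbr[of T v] assms by (simp add: nvertex_graph_def)

lemma e_r_H_graph_ge:
  assumes "k \<le> n"
  shows "k * (n - 1) ^ r + (n - k) * k ^ r \<le> e_r r (H_graph k n)"
proof (rule e_r_ge_of_degrees[OF nvertex_H_graph assms])
  fix v assume "v < k"
  then show "n - 1 \<le> card (nbr (H_graph k n) v)"
    using assms by (intro card_nbr_ge[OF nvertex_H_graph, of "{0..<n} - {v}"]) (auto simp: nbr_H_graph)
next
  fix v assume "k \<le> v" "v < n"
  then show "k \<le> card (nbr (H_graph k n) v)"
    using assms by (intro card_nbr_ge[OF nvertex_H_graph, of "{0..<k}"]) (auto simp: nbr_H_graph)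
qed simp

lemma e_r_H_star_ge:
  assumes "k + 1 < n"
  shows "k * (n - 1) ^ r + (n - k) * k ^ r \<le> e_r r (H_star k n)"
proof (rule e_r_ge_of_degrees[OF nvertex_H_star[OF assms]])
  fix v assume "v < k"
  then show "n - 1 \<le> card (nbr (H_star k n) v)"
    using assms by (intro card_nbr_ge[OF nvertex_H_star[OF assms], of "{0..<n} - {v}"])
      (auto simp: nbr_H_graph nbr_H_star)
next
  fix v assume "k \<le> v" "v < n"
  then show "k \<le> card (nbr (H_star k n) v)"
    using assms by (intro card_nbr_ge[OF nvertex_H_star[OF assms], of "{0..<k}"])
      (auto simp: nbr_H_graph nbr_H_star)
qed (use assms in auto)

lemma e_r_F_graph_ge:
  assumes "n \<ge> 2"
  shows "(n - 1) ^ r + (n - 2) * 2 ^ r \<le> e_r r (F_graph n)"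
proof -
  have "1 * (n - 1) ^ r + (n - 1 - 1) * 2 ^ r \<le> e_r r (F_graph n)"
  proof (rule e_r_ge_of_degrees[OF nvertex_F_graph])
    fix v :: nat assume "v < 1"
    then show "n - 1 \<le> card (nbr (F_graph n) v)"
      by (intro card_nbr_ge[OF nvertex_F_graph, of "{1..<n}"]) (auto simp: nbr_F_graph)
  next
    fix v assume v: "1 \<le> v" "v < n - 1"
    let ?w = "if odd v then v + 1 else v - 1"
    have "{0, ?w} \<subseteq> nbr (F_graph n) v" "?w \<noteq> 0"
      using v by (auto simp: nbr_F_graph elim!: evenE oddE)
    then show "2 \<le> card (nbr (F_graph n) v)"
      by (intro card_nbr_ge[OF nvertex_F_graph, of "{0, ?w}"]) simp_all
  qed (use assms in auto)
  then show ?thesis by (simp add: numeral_2_eq_2)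
qed

section \<open>The target graphs contain no broom\<close>

lemma containsE_broom:
  assumes "contains T (broom l s)"
  obtains f where "inj_on f {0..<l + s}" "\<And>i. Suc i < l \<Longrightarrow> f (Suc i) \<in> nbr T (f i)"
    "\<And>j. l \<le> j \<Longrightarrow> j < l + s \<Longrightarrow> l \<ge> 2 \<Longrightarrow> f j \<in> nbr T (f 1)"
proof -
  have v: "verts (broom l s) = {0..<l+s}" by (simp add: broom_def verts_def)
  from assms obtain f where f: "inj_on f {0..<l+s}"
    and e: "\<And>u v. u < l + s \<Longrightarrow> v < l + s \<Longrightarrow> {u, v} \<in> edges (broom l s) \<Longrightarrow> {f u, f v} \<in> edges T"
    by (auto simp: contains_def v)
  show thesis
  proof (rule that[OF f])
    fix i assume "Suc i < l"
    then show "f (Suc i) \<in> nbr T (f i)"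
      using e[of i "Suc i"] by (auto simp: nbr_def broom_def edges_def)
  next
    fix j assume "l \<le> j" "j < l + s" "l \<ge> 2"
    then show "f j \<in> nbr T (f 1)"
      using e[of 1 j] by (auto simp: nbr_def broom_def edges_def)
  qed
qed

text \<open>Each of the disjoint index pairs contributes its own value below \<open>k\<close>. The
  offset \<open>a\<close> makes the bound available for matchings of a path starting at its first or
  its second vertex.\<close>

lemma matching_cover_bound:
  fixes f :: "nat \<Rightarrow> nat"
  assumes inj: "inj_on f {a..<a + 2 * m}" and cov: "\<And>i. i < m \<Longrightarrow> f (a + 2 * i) < k \<or> f (a + 2 * i + 1) < k"
  shows "m \<le> k"
proof -
  define h where "h i = (if f (a + 2 * i) < k then a + 2 * i else a + 2 * i + 1)" for i
  have "inj_on h {0..<m}" 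
    by (rule inj_on_inverseI[where g = "\<lambda>x. (x - a) div 2"]) (auto simp: h_def)
  moreover have "h ` {0..<m} \<subseteq> {a..<a + 2 * m}" by (auto simp: h_def)
  ultimately have "inj_on (f \<circ> h) {0..<m}" using inj by (meson comp_inj_on inj_on_subset)
  moreover have "(f \<circ> h) ` {0..<m} \<subseteq> {0..<k}" using cov by (fastforce simp: h_def)
  ultimately have "card {0..<m} \<le> card {0..<k}" by (rule card_inj_on_le) simp
  then show ?thesis by simp
qed

text \<open>A path on \<open>2 * k + 2\<close> vertices has a matching with \<open>k + 1\<close>
  edges, each of which would have to use another of the \<open>k\<close> clique vertices.\<close>

lemma H_graph_broom_free: "\<not> contains (H_graph k n) (broom (2 * k + 2) s)"
proof
  assume "contains (H_graph k n) (broom (2 * k + 2) s)"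
  then obtain f where f: "inj_on f {0..<2 * k + 2 + s}"
    "\<And>i. Suc i < 2 * k + 2 \<Longrightarrow> f (Suc i) \<in> nbr (H_graph k n) (f i)"
    by (rule containsE_broom) blast
  have "k + 1 \<le> k"
  proof (rule matching_cover_bound)
    show "inj_on f {0..<0 + 2 * (k + 1)}" using f(1) by (rule inj_on_subset) auto
    show "f (0 + 2 * i) < k \<or> f (0 + 2 * i + 1) < k" if "i < k + 1" for i
      using f(2)[of "2 * i"] that by (auto simp: nbr_H_graph)
  qed
  then show False by simp
qed

text \<open>A path on \<open>2k+3\<close> vertices has two edge-disjoint near-perfect matchings with \<open>k+1\<close> edges each. Only \<open>k\<close>
  edges of a matching can meet the clique, so both would have to contain the extra edge.\<close>

lemma H_star_broom_free: "\<not> contains (H_star k n) (broom (2 * k + 3) s)"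
proof
  assume "contains (H_star k n) (broom (2 * k + 3) s)"
  then obtain f where f: "inj_on f {0..<2 * k + 3 + s}"
    "\<And>i. Suc i < 2 * k + 3 \<Longrightarrow> f (Suc i) \<in> nbr (H_star k n) (f i)"
    by (rule containsE_broom) blast
  have edge: "f i < k \<or> f (Suc i) < k \<or> {f i, f (Suc i)} = {k, k + 1}" if "Suc i < 2 * k + 3" for i
    using f(2)[OF that] by (auto simp: nbr_H_star nbr_H_graph)
  have ex: "\<exists>i. i < k + 1 \<and> {f (a + 2 * i), f (a + 2 * i + 1)} = {k, k + 1}" if "a \<le> 1" for a
  proof (rule ccontr)
    assume none: "\<not> ?thesis"
    have "k + 1 \<le> k"
    proof (rule matching_cover_bound)
      show "inj_on f {a..<a + 2 * (k + 1)}" using f(1) by (rule inj_on_subset) (use that in auto)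
      show "f (a + 2 * i) < k \<or> f (a + 2 * i + 1) < k" if i: "i < k + 1" for i
      proof -
        have "Suc (a + 2 * i) < 2 * k + 3" using i \<open>a \<le> 1\<close> by simp
        from edge[OF this] none i show ?thesis unfolding Suc_eq_plus1 by blast
      qed
    qed
    then show False by simp
  qed
  obtain i where i: "i < k + 1" "{f (2 * i), f (2 * i + 1)} = {k, k + 1}" using ex[of 0] by auto
  obtain j where j: "j < k + 1" "{f (2 * j + 1), f (2 * j + 2)} = {k, k + 1}" using ex[of 1] by auto
  have inj: "x = y" if "f x = f y" "x < 2 * k + 3" "y < 2 * k + 3" for x y
    using f(1) that by (auto dest: inj_onD)
  have "f (2 * i) \<in> {f (2 * j + 1), f (2 * j + 2)}" "f (2 * i + 1) \<in> {f (2 * j + 1), f (2 * j + 2)}"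
    using i j by auto
  moreover have "2 * i < 2 * k + 3" "2 * i + 1 < 2 * k + 3" "2 * j + 1 < 2 * k + 3" "2 * j + 2 < 2 * k + 3"
    using i j by auto
  ultimately have "2 * i = 2 * j + 1 \<or> 2 * i = 2 * j + 2" "2 * i + 1 = 2 * j + 1 \<or> 2 * i + 1 = 2 * j + 2"
    using inj by blast+
  then show False by presburger
qed

text \<open>A vertex other than the centre 0 has at most one neighbour besides 0. As
  \<open>s > 0\<close>, vertex 1 of the broom has three neighbours and must be the centre; then
  vertex 3 has two neighbours that are not the centre.\<close>

lemma F_graph_broom_free:
  assumes "s > 0" shows "\<not> contains (F_graph n) (broom 5 s)"
proof
  assume "contains (F_graph n) (broom 5 s)"
  then obtain f where f: "inj_on f {0..<5 + s}"
    "\<And>i. Suc i < 5 \<Longrightarrow> f (Suc i) \<in> nbr (F_graph n) (f i)"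
    "\<And>j. 5 \<le> j \<Longrightarrow> j < 5 + s \<Longrightarrow> f j \<in> nbr (F_graph n) (f 1)"
    by (elim containsE_broom) auto
  have inj: "f x \<noteq> f y" if "x \<noteq> y" "x < 6" "y < 6" for x y
    using f(1) that assms by (auto dest: inj_onD)
  have unique: "x = y" if "x \<in> nbr (F_graph n) v" "y \<in> nbr (F_graph n) v" "x \<noteq> 0" "y \<noteq> 0" "v \<noteq> 0" for x y v
    using that by (auto simp: nbr_F_graph)
  have a: "f 0 \<in> nbr (F_graph n) (f 1)" "f 2 \<in> nbr (F_graph n) (f 1)" "f 5 \<in> nbr (F_graph n) (f 1)"
    "f 2 \<in> nbr (F_graph n) (f 3)" "f 4 \<in> nbr (F_graph n) (f 3)"
    using f(2)[of 0] f(2)[of 1] f(2)[of 2] f(2)[of 3] f(3)[of 5] assms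
      nbr_sym[of "f 0" _ "f 1"] nbr_sym[of "f 2" _ "f 3"]
    by (simp_all add: numeral_eq_Suc)
  have "f 1 = 0"
    using unique[OF a(1,2)] unique[OF a(1,3)] unique[OF a(2,3)] inj[of 0 2] inj[of 0 5] inj[of 2 5]
    by (cases "f 0 = 0"; cases "f 2 = 0") auto
  then show False
    using unique[OF a(4,5)] inj[of 2 4] inj[of 1 2] inj[of 1 3] inj[of 1 4] by auto
qed

subsection \<open>Edges outside the vertices of almost full degree\<close>

context near_full
begin

abbreviation V where "V \<equiv> verts G"

lemma finV: "finite V"
  by (rule finite_verts[OF G])

lemma obtain_A: obtains a where "a \<in> A"
  using A by fastforce

lemma card_non_W_le: "card (V - A - W) \<le> deficiency G A"
  using card_not_common_nbr_le[OF G A(1)] W(1) by simp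

lemma W_eq_of_no_deficiency:
  assumes "deficiency G A = 0" shows "W = V - A"
proof -
  have "V - A - W = {}" using card_non_W_le assms finV by simp
  then show ?thesis using W by auto
qed

lemma no_path_at_W:
  assumes "\<not> contains G (broom (2 * k + 3) s)"
    "y \<in> W" "v \<in> V - A" "t \<in> V - A" "v \<in> nbr G y" "t \<in> nbr G v"
  shows "t = y"
proof (rule ccontr)
  obtain a where "a \<in> A" by (rule obtain_A)
  moreover assume "t \<noteq> y"
  ultimately show False
    using path_at_A_nbr[of y v t a] assms W(1) W_sub(2)[of a] by auto
qed

text \<open>Sending \<open>y\<close> to a chosen neighbour outside \<open>A \<union> W\<close> is
  injective: two vertices with the same image would be the ends of a forbidden outside path on three
  vertices.\<close>

lemma W_non_W_edges_bound:
  assumes "\<not> contains G (broom (2 * k + 3) s)"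
  shows "card {y \<in> W. nbr G y \<inter> (V - A - W) \<noteq> {}} \<le> card (V - A - W)"
proof -
  let ?Y = "{y \<in> W. nbr G y \<inter> (V - A - W) \<noteq> {}}"
  have "\<forall>y\<in>?Y. \<exists>z. z \<in> nbr G y \<inter> (V - A - W)" by blast
  from bchoice[OF this] obtain p where p: "\<And>y. y \<in> ?Y \<Longrightarrow> p y \<in> nbr G y \<inter> (V - A - W)" by blast
  have "inj_on p ?Y"
  proof (rule inj_onI)
    fix y y' assume y: "y \<in> ?Y" "y' \<in> ?Y" "p y = p y'"
    have "p y \<in> nbr G y" "p y \<in> V - A" "y' \<in> nbr G (p y)" "y' \<in> V - A"
      using p[OF y(1)] p[OF y(2)] y(2,3) W(1) by (auto simp: nbr_sym)
    then show "y = y'" using no_path_at_W[OF assms, of y "p y" y'] y(1) by simp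
  qed
  moreover have "p ` ?Y \<subseteq> V - A - W" using p by blast
  ultimately show ?thesis using finV by (intro card_inj_on_le) auto
qed

lemma e_r_less:
  assumes "r \<ge> 2" and free: "\<not> contains G (broom l s)" "l \<ge> 2"
    and T: "T \<subseteq> V - A" "\<And>v. v \<in> T \<Longrightarrow> nbr G v \<subseteq> A \<union> T" "card T \<le> 4 * deficiency G A"
    and D: "\<And>v. v \<in> V - A - T \<Longrightarrow> degree G v \<le> D" and "deficiency G A \<ge> 1"
    and big: "4 * deficiency G A * (8 * (k + 1) ^ r * (2 * (l + s) + 1)) \<le> card V - 1" "2 * D ^ r < card V - 1"
  shows "e_r r G + D ^ r < k * (card V - 1) ^ r + (card V - k) * D ^ r"
  by (rule e_r_less_of_deficiency[OF G refl \<open>r \<ge> 2\<close> _ A(1,2) refl _ T D big])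
    (use broom_free_edge_bound[OF G free] \<open>deficiency G A \<ge> 1\<close> in auto)

lemma degree_le_of_nbr_subset:
  assumes "nbr G v \<subseteq> A" shows "degree G v \<le> k"
  using card_mono[OF finA assms] A by (simp add: degree_eq_card_nbr[OF G])

lemma even_no_R_edge_at_W:
  assumes "\<not> contains G (broom (2 * k + 2) s)" "v \<in> W" shows "nbr G v \<subseteq> A"
proof
  obtain a where a: "a \<in> A" by (rule obtain_A)
  fix u assume u: "u \<in> nbr G v"
  then have "u \<in> V" using nbr_in_verts[OF G] by blast
  then show "u \<in> A"
    using edge_at_A_nbr[of v u a] u a assms W(1) W_sub(2)[of a] by auto
qed

text \<open>The exceptional vertices are those with a neighbour outside \<open>A\<close>. No common
  neighbour of \<open>A\<close> is among them, so each is charged to a missing edge.\<close>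

lemma e_r_less_even:
  assumes "r \<ge> 2" and free: "\<not> contains G (broom (2 * k + 2) s)" and "deficiency G A \<ge> 1"
    and big: "4 * deficiency G A * (8 * (k + 1) ^ r * (2 * (2 * k + 2 + s) + 1)) \<le> card V - 1" "2 * k ^ r < card V - 1"
  shows "e_r r G < k * (card V - 1) ^ r + (card V - k) * k ^ r"
proof -
  let ?T = "{v \<in> V - A. \<not> nbr G v \<subseteq> A}"
  have "?T \<subseteq> V - A - W" using even_no_R_edge_at_W[OF free] by blast
  then have "card ?T \<le> card (V - A - W)" using finV by (intro card_mono) auto
  then have "card ?T \<le> 4 * deficiency G A" using card_non_W_le by linarith
  moreover have "nbr G v \<subseteq> A \<union> ?T" if v: "v \<in> ?T" for v
  proof
    fix u assume u: "u \<in> nbr G v"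
    then have "u \<in> V" "v \<in> nbr G u" using nbr_in_verts[OF G u] nbr_sym[of u G v] by auto
    with v show "u \<in> A \<union> ?T" by auto
  qed
  ultimately have "e_r r G + k ^ r < k * (card V - 1) ^ r + (card V - k) * k ^ r"
    by (intro e_r_less[OF \<open>r \<ge> 2\<close> free _ _ _ _ _ _ big]) (use assms degree_le_of_nbr_subset in auto)
  then show ?thesis by simp
qed

text \<open>An outside edge at \<open>W\<close> disjoint from \<open>u, v\<close> allows the
  splicing of two edges, and one sharing a single vertex with it makes an outside path on three
  vertices that starts in \<open>W\<close>.\<close>

lemma no_two_R_edges_at_W:
  assumes free: "\<not> contains G (broom (2 * k + 3) s)" and ks: "k \<ge> 2 \<or> s = 0"
    and "u \<in> W" "v \<in> W" "v \<in> nbr G u" and w: "w \<in> W" "t \<in> V - A" "t \<in> nbr G w"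
  shows "{w, t} = {u, v}"
proof -
  obtain a where a: "a \<in> A" by (rule obtain_A)
  have WR: "W \<subseteq> V - A" using W by auto
  have uv: "u \<in> nbr G v" "w \<in> nbr G t"
    using nbr_sym[of u G v] nbr_sym[of w G t] assms by auto
  note R = subsetD[OF WR assms(3)] subsetD[OF WR assms(4)] subsetD[OF WR w(1)]
  have "w \<in> nbr G a" using W_sub(2)[OF a] w(1) by blast
  then have "{u, v} \<inter> {w, t} \<noteq> {}"
    using two_edges[of u v w t a] free assms(3-5) R(3) w(2,3) a ks by blast
  then consider "w = u" | "w = v" | "t = u" | "t = v" by blast
  then show ?thesis
  proof cases
    case 1
    then show ?thesis using no_path_at_W[OF free, of v u t] assms uv R by auto
  next
    case 2
    then show ?thesis using no_path_at_W[OF free, of u v t] assms uv R by auto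
  next
    case 3
    then show ?thesis using no_path_at_W[OF free, of v u w] assms uv R by auto
  next
    case 4
    then show ?thesis using no_path_at_W[OF free, of u v w] assms uv R by auto
  qed
qed

text \<open>Either an edge inside \<open>W\<close> excludes all other outside edges at
  \<open>W\<close>, so that only its ends are exceptional in \<open>W\<close>, or each exceptional
  vertex of \<open>W\<close> has a neighbour outside \<open>A \<union> W\<close> and the injection
  counts them.\<close>

lemma e_r_less_odd:
  assumes "r \<ge> 2" and free: "\<not> contains G (broom (2 * k + 3) s)" and "deficiency G A \<ge> 1"
    and ks: "k \<ge> 2 \<or> s = 0"
    and big: "4 * deficiency G A * (8 * (k + 1) ^ r * (2 * (2 * k + 3 + s) + 1)) \<le> card V - 1" "2 * k ^ r < card V - 1"
  shows "e_r r G < k * (card V - 1) ^ r + (card V - k) * k ^ r"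
proof -
  let ?T = "{v \<in> V - A. \<not> nbr G v \<subseteq> A}"
  let ?Z = "V - A - W"
  have "card (?T \<inter> W) \<le> card ?Z + 2"
  proof (cases "\<exists>u\<in>W. \<exists>v\<in>W. v \<in> nbr G u")
    case True
    then obtain u v where uv: "u \<in> W" "v \<in> W" "v \<in> nbr G u" by blast
    have "?T \<inter> W \<subseteq> {u, v}"
    proof
      fix w assume w: "w \<in> ?T \<inter> W"
      then obtain t where "t \<in> nbr G w" "t \<notin> A" by blast
      then show "w \<in> {u, v}"
        using no_two_R_edges_at_W[OF free ks uv, of w t] w nbr_in_verts[OF G] by blast
    qed
    then have "card (?T \<inter> W) \<le> card {u, v}" by (intro card_mono) auto
    also have "\<dots> \<le> 2" by (simp add: card_insert_if)
    finally show ?thesis by simp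
  next
    case False
    have "?T \<inter> W \<subseteq> {y \<in> W. nbr G y \<inter> ?Z \<noteq> {}}"
    proof
      fix w assume w: "w \<in> ?T \<inter> W"
      then obtain t where "t \<in> nbr G w" "t \<notin> A" by blast
      then have "t \<in> nbr G w \<inter> ?Z" using False w nbr_in_verts[OF G] by blast
      then show "w \<in> {y \<in> W. nbr G y \<inter> ?Z \<noteq> {}}" using w by blast
    qed
    then have "card (?T \<inter> W) \<le> card {y \<in> W. nbr G y \<inter> ?Z \<noteq> {}}"
      using finW by (intro card_mono) auto
    then show ?thesis using W_non_W_edges_bound[OF free] by linarith
  qed
  moreover have "card ?T \<le> card (?T \<inter> W) + card ?Z"
  proof -
    have "card ?T \<le> card ((?T \<inter> W) \<union> ?Z)" using finV finW by (intro card_mono) auto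
    also have "\<dots> \<le> card (?T \<inter> W) + card ?Z" by (rule card_Un_le)
    finally show ?thesis .
  qed
  \<comment> \<open>With \<open>q\<close> the deficiency, the count is at most
    \<open>2 * q + 2\<close>, and \<open>q \<ge> 1\<close> turns it into \<open>4 * q\<close>: the
    origin of the constant 4.\<close>
  ultimately have "card ?T \<le> 4 * deficiency G A"
    using card_non_W_le \<open>deficiency G A \<ge> 1\<close> by linarith
  moreover have "nbr G v \<subseteq> A \<union> ?T" if v: "v \<in> ?T" for v
  proof
    fix u assume u: "u \<in> nbr G v"
    then have "u \<in> V" "v \<in> nbr G u" using nbr_in_verts[OF G u] nbr_sym[of u G v] by auto
    with v show "u \<in> A \<union> ?T" by auto
  qed
  ultimately have "e_r r G + k ^ r < k * (card V - 1) ^ r + (card V - k) * k ^ r"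
    by (intro e_r_less[OF \<open>r \<ge> 2\<close> free _ _ _ _ _ _ big]) (use assms degree_le_of_nbr_subset in auto)
  then show ?thesis by simp
qed

text \<open>Once \<open>W = V - A\<close>, this says that the outside edges form a matching, which
  is all that can be said for \<open>k = 1\<close> and \<open>s > 0\<close>.\<close>

lemma R_degree_le_1:
  assumes free: "\<not> contains G (broom (2 * k + 3) s)" and v: "v \<in> V - A"
    and xy: "x \<in> nbr G v \<inter> W" "y \<in> nbr G v - A"
  shows "x = y"
  using no_path_at_W[OF free, of x v y] assms nbr_sym[of x G v] nbr_in_verts[OF G, of y v] by auto

text \<open>The exceptional set consists of the vertices outside \<open>A \<union> W\<close> and their neighbours in \<open>W\<close>; what
  remains outside \<open>A\<close> induces a matching.\<close>

lemma e_r_less_matching: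
  assumes "r \<ge> 2" and free: "\<not> contains G (broom (2 * k + 3) s)" and "deficiency G A \<ge> 1"
    and big: "4 * deficiency G A * (8 * (k + 1) ^ r * (2 * (2 * k + 3 + s) + 1)) \<le> card V - 1"
      "2 * (k + 1) ^ r < card V - 1"
  shows "e_r r G + (k + 1) ^ r < k * (card V - 1) ^ r + (card V - k) * (k + 1) ^ r"
proof -
  let ?Z = "V - A - W" and ?Y = "{y \<in> W. nbr G y \<inter> (V - A - W) \<noteq> {}}"
  let ?T = "?Z \<union> ?Y"
  have WR: "W \<subseteq> V - A" using W by auto
  have "card ?T \<le> card ?Z + card ?Y" by (rule card_Un_le)
  also have "\<dots> \<le> 4 * deficiency G A"
    using card_non_W_le W_non_W_edges_bound[OF free] by linarith
  finally have "card ?T \<le> 4 * deficiency G A" .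
  moreover have "nbr G v \<subseteq> A \<union> ?T" if v: "v \<in> ?T" for v
  proof
    fix u assume u: "u \<in> nbr G v"
    then have uV: "u \<in> V" "v \<in> nbr G u" using nbr_in_verts[OF G u] nbr_sym[of u G v] by auto
    show "u \<in> A \<union> ?T"
    proof (rule ccontr)
      assume n: "u \<notin> A \<union> ?T"
      \<comment> \<open>If \<open>v\<close> were outside \<open>A \<union> W\<close>, its neighbour
        \<open>u\<close> would belong to \<open>?Y\<close>. So \<open>v\<close> is in
        \<open>?Y\<close> and has a second outside neighbour besides \<open>u\<close>.\<close>
      then have "u \<in> W" "v \<in> W" using uV v by auto
      then obtain z where "z \<in> nbr G v" "z \<in> ?Z" using v by blast
      then have "u = z" using R_degree_le_1[OF free, of v u z] u \<open>u \<in> W\<close> \<open>v \<in> W\<close> WR by blast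
      with \<open>z \<in> ?Z\<close> \<open>u \<in> W\<close> show False by blast
    qed
  qed
  moreover have "degree G v \<le> k + 1" if v: "v \<in> V - A - ?T" for v
  proof -
    have vW: "v \<in> W" "nbr G v - A \<subseteq> W" using v nbr_in_verts[OF G] by blast+
    have "card (nbr G v - A) \<le> Suc 0"
      using R_degree_le_1[OF free, of v] v vW finite_nbr[OF G]
      by (subst card_le_Suc0_iff_eq) auto
    moreover have "card (nbr G v) \<le> card (nbr G v - A) + card A"
      using card_Un_le[of "nbr G v - A" A] card_mono[of "(nbr G v - A) \<union> A" "nbr G v"] finA finite_nbr[OF G] by fastforce
    ultimately show ?thesis using A by (simp add: degree_eq_card_nbr[OF G])
  qed
  ultimately show ?thesis
    by (intro e_r_less[OF \<open>r \<ge> 2\<close> free _ _ _ _ _ _ big]) (use assms WR in auto)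
qed

end

text \<open>Matched pairs are listed first and so occupy positions \<open>2 * t\<close> and
  \<open>2 * t + 1\<close>. One centre put in front shifts them to the matching edges of
  \<open>F_graph\<close>.\<close>

lemma obtain_matching_list:
  fixes G :: "'a graph"
  assumes "finite S" "\<And>x y z. x \<in> S \<Longrightarrow> y \<in> S \<Longrightarrow> z \<in> S \<Longrightarrow> y \<in> nbr G x \<Longrightarrow> z \<in> nbr G x \<Longrightarrow> y = z"
    and G: "simple_graph G"
  shows "\<exists>bs. distinct bs \<and> set bs = S \<and>
    (\<forall>i j. i < j \<longrightarrow> j < length bs \<longrightarrow> bs ! j \<in> nbr G (bs ! i) \<longrightarrow> even i \<and> j = i + 1)"
  using assms(1,2)
proof (induction S rule: finite_psubset_induct)
  case (psubset S)
  show ?case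
  proof (cases "\<exists>x\<in>S. \<exists>y\<in>S. y \<in> nbr G x")
    case False
    obtain bs where "set bs = S" "distinct bs" using psubset.hyps finite_distinct_list by blast
    with False show ?thesis by (intro exI[of _ bs]) (metis nth_mem order_less_trans)
  next
    case True
    then obtain x y where xy: "x \<in> S" "y \<in> S" "y \<in> nbr G x" by blast
    have yx: "x \<in> nbr G y" "x \<noteq> y" using xy nbr_sym[of x G y] nbr_in_verts[OF G xy(3)] by auto
    have "S - {x, y} \<subset> S" using xy by blast
    moreover have "b = c" if "a \<in> S - {x, y}" "b \<in> S - {x, y}" "c \<in> S - {x, y}"
      "b \<in> nbr G a" "c \<in> nbr G a" for a b c
      using psubset.prems[of a b c] that by blast
    ultimately obtain cs where cs: "distinct cs" "set cs = S - {x, y}"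
      "\<And>i j. i < j \<Longrightarrow> j < length cs \<Longrightarrow> cs ! j \<in> nbr G (cs ! i) \<Longrightarrow> even i \<and> j = i + 1"
      using psubset.IH[of "S - {x, y}"] by blast
    let ?bs = "x # y # cs"
    have "even i \<and> j = i + 1" if ij: "i < j" "j < length ?bs" "?bs ! j \<in> nbr G (?bs ! i)" for i j
    proof (cases "j \<ge> 2")
      case False
      then have "i = 0" "j = 1" using ij by auto
      then show ?thesis by simp
    next
      case True
      then obtain j' where j': "j = Suc (Suc j')" by (metis Suc_le_D numeral_2_eq_2 Suc_le_mono)
      have mem: "cs ! j' \<in> S - {x, y}" using cs(2) ij j' nth_mem[of j' cs] by auto
      show ?thesis
      proof (cases "i \<ge> 2")
        case True
        then obtain i' where i': "i = Suc (Suc i')" by (metis Suc_le_D numeral_2_eq_2 Suc_le_mono)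
        then show ?thesis using cs(3)[of i' j'] ij j' by auto
      next
        case False
        then have "i = 0 \<or> i = 1" by linarith
        then have "cs ! j' \<in> nbr G x \<or> cs ! j' \<in> nbr G y" using ij j' by auto
        then show ?thesis
          using psubset.prems[of x y "cs ! j'"] psubset.prems[of y x "cs ! j'"] xy yx mem by blast
      qed
    qed
    then show ?thesis using cs xy yx by (intro exI[of _ ?bs]) auto
  qed
qed

section \<open>Graphs with no missing edge at \<open>A\<close>\<close>

context near_full
begin

lemma obtain_vertex_list:
  obtains as where "distinct as" "set as = A" "length as = k"
    "\<And>bs. distinct bs \<Longrightarrow> set bs = V - A \<Longrightarrow> distinct (as @ bs) \<and> set (as @ bs) = V"
proof -
  obtain as where as: "set as = A" "distinct as" using finA finite_distinct_list by blast
  show thesis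
    by (rule that[of as]) (use as A distinct_card[of as] in auto)
qed

lemma isomorphic_even:
  fixes n :: nat
  assumes "card V = n" and free: "\<not> contains G (broom (2 * k + 2) s)" and "deficiency G A = 0"
    and "r \<ge> 1" "e_r r (H_graph k n) \<le> e_r r G"
  shows "isomorphic G (H_graph k n) \<and> e_r r G = e_r r (H_graph k n)"
proof -
  obtain as where as: "set as = A" "length as = k"
    and ext: "\<And>bs. distinct bs \<Longrightarrow> set bs = V - A \<Longrightarrow> distinct (as @ bs) \<and> set (as @ bs) = V"
    by (rule obtain_vertex_list) blast
  obtain bs where bs: "set bs = V - A" "distinct bs" using finV finite_distinct_list by (metis finite_Diff)
  note WR = W_eq_of_no_deficiency[OF \<open>deficiency G A = 0\<close>]
  have len: "length (as @ bs) = n"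
    using ext[OF bs(2,1)] \<open>card V = n\<close> by (metis distinct_card)
  have H: "simple_graph (H_graph k n)" "verts (H_graph k n) = {0..<n}"
    using nvertex_H_graph[of n k] by (auto simp: nvertex_graph_def)
  show ?thesis
  proof (rule isomorphic_of_list_embedding[OF G H \<open>card V = n\<close>])
    fix i j assume ij: "i < j" "j < n" "(as @ bs) ! j \<in> nbr G ((as @ bs) ! i)"
    have "i < k"
    proof (rule ccontr)
      assume "\<not> i < k"
      then have "(as @ bs) ! i \<in> set bs" "(as @ bs) ! j \<in> set bs"
        using ij len as by (auto simp: nth_append)
      then show False
        using even_no_R_edge_at_W[OF free, of "(as @ bs) ! i"] ij(3) bs(1) WR by blast
    qed
    then show "j \<in> nbr (H_graph k n) i" using ij by (simp add: nbr_H_graph)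
  qed (use ext[OF bs(2,1)] assms in auto)
qed

text \<open>All vertices outside \<open>A\<close> are now common neighbours, so at most one outside
  edge exists; listing its ends directly after \<open>A\<close> places it on \<open>k\<close> and
  \<open>k + 1\<close>.\<close>

lemma isomorphic_odd:
  fixes n :: nat
  assumes "card V = n" and free: "\<not> contains G (broom (2 * k + 3) s)" and "deficiency G A = 0"
    and ks: "k \<ge> 2 \<or> s = 0" and "r \<ge> 1" "k + 1 < n" "e_r r (H_star k n) \<le> e_r r G"
  shows "isomorphic G (H_star k n) \<and> e_r r G = e_r r (H_star k n)"
proof -
  obtain as where as: "set as = A" "length as = k"
    and ext: "\<And>bs. distinct bs \<Longrightarrow> set bs = V - A \<Longrightarrow> distinct (as @ bs) \<and> set (as @ bs) = V"
    by (rule obtain_vertex_list) blast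
  note WR = W_eq_of_no_deficiency[OF \<open>deficiency G A = 0\<close>]
  obtain bs where bs: "distinct bs" "set bs = V - A"
    "\<And>i j. i < j \<Longrightarrow> j < length bs \<Longrightarrow> bs ! j \<in> nbr G (bs ! i) \<Longrightarrow> i = 0 \<and> j = 1"
  proof (cases "\<exists>u\<in>W. \<exists>v\<in>W. v \<in> nbr G u")
    case True
    then obtain u v where uv: "u \<in> W" "v \<in> W" "v \<in> nbr G u" by blast
    then have "u \<noteq> v" using nbr_in_verts[OF G] by blast
    obtain cs where cs: "set cs = V - A - {u, v}" "distinct cs"
      using finV finite_distinct_list by (metis finite_Diff)
    show thesis
    proof (rule that[of "u # v # cs"])
      show d: "distinct (u # v # cs)" and st: "set (u # v # cs) = V - A"
        using cs \<open>u \<noteq> v\<close> uv WR by auto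
      fix i j assume ij: "i < j" "j < length (u # v # cs)" "(u # v # cs) ! j \<in> nbr G ((u # v # cs) ! i)"
      let ?bs = "u # v # cs"
      have "?bs ! i \<in> V - A" "?bs ! j \<in> V - A" using ij st nth_mem by (metis order_less_trans)+
      then have "{?bs ! i, ?bs ! j} = {u, v}"
        using no_two_R_edges_at_W[OF free ks uv, of "?bs ! i" "?bs ! j"] ij(3) WR by blast
      then have "{?bs ! i, ?bs ! j} = {?bs ! 0, ?bs ! 1}" by simp
      moreover have "i < length ?bs" "0 < length ?bs" "1 < length ?bs" using ij by auto
      note eq = nth_eq_iff_index_eq[OF d this(1,2)] nth_eq_iff_index_eq[OF d this(1,3)]
        nth_eq_iff_index_eq[OF d ij(2) this(2)] nth_eq_iff_index_eq[OF d ij(2) this(3)]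
      ultimately have "(i = 0 \<and> j = 1) \<or> (i = 1 \<and> j = 0)"
        unfolding doubleton_eq_iff eq by blast
      then show "i = 0 \<and> j = 1" using ij by auto
    qed
  next
    case False
    obtain bs where b: "set bs = V - A" "distinct bs" using finV finite_distinct_list by (metis finite_Diff)
    have "bs ! j \<notin> nbr G (bs ! i)" if "i < j" "j < length bs" for i j
      using False that nth_mem[of i bs] nth_mem[of j bs] b(1) WR by auto
    then show thesis using that[of bs] b by blast
  qed
  have len: "length (as @ bs) = n"
    using ext[OF bs(1,2)] \<open>card V = n\<close> by (metis distinct_card)
  have H: "simple_graph (H_star k n)" "verts (H_star k n) = {0..<n}"
    using nvertex_H_star[OF \<open>k + 1 < n\<close>] by (auto simp: nvertex_graph_def)
  show ?thesis
  proof (rule isomorphic_of_list_embedding[OF G H \<open>card V = n\<close>])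
    fix i j assume ij: "i < j" "j < n" "(as @ bs) ! j \<in> nbr G ((as @ bs) ! i)"
    show "j \<in> nbr (H_star k n) i"
    proof (cases "i < k")
      case True
      then show ?thesis using ij by (simp add: nbr_H_graph nbr_H_star)
    next
      case False
      then have "i - k < j - k" "j - k < length bs" "bs ! (j - k) \<in> nbr G (bs ! (i - k))"
        using ij len as by (auto simp: nth_append)
      then have "i - k = 0" "j - k = 1" using bs(3) by blast+
      then have "i = k" "j = k + 1" using False by linarith+
      then show ?thesis by (simp add: nbr_H_star)
    qed
  qed (use ext[OF bs(1,2)] assms in auto)
qed

lemma isomorphic_matching:
  fixes n :: nat
  assumes "card V = n" and free: "\<not> contains G (broom (2 * k + 3) s)" and "deficiency G A = 0"
    and "k = 1" "r \<ge> 1" "e_r r (F_graph n) \<le> e_r r G"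
  shows "isomorphic G (F_graph n) \<and> e_r r G = e_r r (F_graph n)"
proof -
  obtain as where as: "set as = A" "length as = k"
    and ext: "\<And>bs. distinct bs \<Longrightarrow> set bs = V - A \<Longrightarrow> distinct (as @ bs) \<and> set (as @ bs) = V"
    by (rule obtain_vertex_list) blast
  note WR = W_eq_of_no_deficiency[OF \<open>deficiency G A = 0\<close>]
  have "y = z" if "x \<in> V - A" "y \<in> V - A" "z \<in> V - A" "y \<in> nbr G x" "z \<in> nbr G x" for x y z
    using R_degree_le_1[OF free, of x y z] that WR by blast
  then obtain bs where bs: "distinct bs" "set bs = V - A"
    "\<And>i j. i < j \<Longrightarrow> j < length bs \<Longrightarrow> bs ! j \<in> nbr G (bs ! i) \<Longrightarrow> even i \<and> j = i + 1"
    using obtain_matching_list[OF _ _ G, of "V - A"] finV by blast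
  have len: "length (as @ bs) = n"
    using ext[OF bs(1,2)] \<open>card V = n\<close> by (metis distinct_card)
  have H: "simple_graph (F_graph n)" "verts (F_graph n) = {0..<n}"
    using nvertex_F_graph[of n] by (auto simp: nvertex_graph_def)
  show ?thesis
  proof (rule isomorphic_of_list_embedding[OF G H \<open>card V = n\<close>])
    fix i j assume ij: "i < j" "j < n" "(as @ bs) ! j \<in> nbr G ((as @ bs) ! i)"
    show "j \<in> nbr (F_graph n) i"
    proof (cases "i = 0")
      case True
      then show ?thesis using ij by (simp add: nbr_F_graph)
    next
      case False
      then have "i - 1 < j - 1" "j - 1 < length bs" "bs ! (j - 1) \<in> nbr G (bs ! (i - 1))"
        using ij len as \<open>k = 1\<close> by (auto simp: nth_append)
      then have "even (i - 1)" "j - 1 = i - 1 + 1" using bs(3) by blast+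
      then have "odd i" "j = i + 1" using False ij by auto
      then show ?thesis using ij by (simp add: nbr_F_graph)
    qed
  qed (use ext[OF bs(1,2)] assms in auto)
qed

end

section \<open>Assembly for large \<open>n\<close>\<close>

lemma near_full_structure:
  fixes k s l r :: nat
  assumes "k \<ge> 1" "r \<ge> 2" and l: "l = 2 * k + 2 \<or> l = 2 * k + 3"
  shows "\<exists>N. \<forall>n\<ge>N. \<forall>G :: nat graph. nvertex_graph n G \<longrightarrow> \<not> contains G (broom l s) \<longrightarrow>
    k * (n - 1) ^ r \<le> e_r r G \<longrightarrow>
    (\<exists>A. near_full G A {w \<in> verts G - A. A \<subseteq> nbr G w} k s \<and>
      4 * deficiency G A * (8 * (k + 1) ^ r * (2 * (l + s) + 1)) \<le> n - 1)"
proof -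
  define b where "b = 8 * (k + 1) ^ r * (2 * (l + s) + 1)"
  have b: "b \<ge> 1" by (simp add: b_def Suc_le_eq)
  have "1 \<le> l + s" "1 \<le> 8 * k * b" using l b \<open>k \<ge> 1\<close> by auto
  \<comment> \<open>With precision \<open>8 * k * b\<close> at each of \<open>k\<close> vertices,
    the deficiency \<open>q\<close> satisfies \<open>8 * b * q \<le> n\<close>. This implies both
    the required \<open>4 * q * b \<le> n - 1\<close> and \<open>8 * q \<le> n\<close>, which keeps
    the set of common neighbours large.\<close>
  from near_full_degree_vertices[OF \<open>r \<ge> 2\<close> this, where 'a = nat and k = k and M = "s + l + k + 2"]
  obtain N where N: "\<forall>n\<ge>N. \<forall>G :: nat graph. simple_graph G \<longrightarrow> card (verts G) = n \<longrightarrow>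
    (\<Sum>v\<in>verts G. degree G v) \<le> 2 * (l + s) * n \<longrightarrow>
    (\<forall>S\<subseteq>verts G. card S = k + 1 \<longrightarrow> card (\<Inter>v\<in>S. nbr G v) < s + l + k + 2) \<longrightarrow>
    k * (n - 1) ^ r \<le> e_r r G \<longrightarrow>
    (\<exists>A\<subseteq>verts G. card A = k \<and> (\<forall>a\<in>A. (8 * k * b) * (n - degree G a) \<le> n))"
    by (rule exE)
  show ?thesis
  proof (intro exI[of _ "N + 4 * k + 2 * s + 20"] allI impI)
    fix n and G :: "nat graph"
    assume n: "N + 4 * k + 2 * s + 20 \<le> n" and G': "nvertex_graph n G"
      and free: "\<not> contains G (broom l s)" and e: "k * (n - 1) ^ r \<le> e_r r G"
    have G: "simple_graph G" "card (verts G) = n" using G' by (auto simp: nvertex_graph_def)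
    note fV = finite_verts[OF G(1)]
    have "(\<Sum>v\<in>verts G. degree G v) = (\<Sum>v\<in>verts G. card (nbr G v \<inter> verts G))"
      using nbr_subset[OF G(1)] by (intro sum.cong) (auto simp: degree_eq_card_nbr[OF G(1)] intro!: arg_cong[of _ _ card])
    also have "\<dots> \<le> 2 * (l + s) * n"
      using broom_free_edge_bound[OF G(1) free _ order_refl] l G by auto
    finally have sum: "(\<Sum>v\<in>verts G. degree G v) \<le> 2 * (l + s) * n" .
    have noK: "\<forall>S\<subseteq>verts G. card S = k + 1 \<longrightarrow> card (\<Inter>v\<in>S. nbr G v) < s + l + k + 2"
      using broom_free_no_biclique[OF G(1) free l] by blast
    obtain A where A: "A \<subseteq> verts G" "card A = k" "\<And>a. a \<in> A \<Longrightarrow> (8 * k * b) * (n - degree G a) \<le> n"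
      using N[rule_format, OF _ G sum noK[rule_format] e] n by auto
    let ?W = "{w \<in> verts G - A. A \<subseteq> nbr G w}"
    have fA: "finite A" using A fV finite_subset by blast
    have "8 * k * b * deficiency G A = (\<Sum>a\<in>A. 8 * k * b * (card (verts G) - 1 - degree G a))"
      by (rule sum_distrib_left)
    also have "\<dots> \<le> (\<Sum>a\<in>A. n)"
    proof (rule sum_mono)
      fix a assume "a \<in> A"
      have "8 * k * b * (card (verts G) - 1 - degree G a) \<le> 8 * k * b * (n - degree G a)"
        using G by (intro mult_le_mono2) simp
      then show "8 * k * b * (card (verts G) - 1 - degree G a) \<le> n" using A(3)[OF \<open>a \<in> A\<close>] by linarith
    qed
    also have "\<dots> = k * n" using A by simp
    finally have "k * (8 * b * deficiency G A) \<le> k * n" by (simp only: mult_ac)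
    then have q: "8 * b * deficiency G A \<le> n" using \<open>k \<ge> 1\<close> by simp
    have "8 * 1 * deficiency G A \<le> 8 * b * deficiency G A" using b by (intro mult_le_mono1 mult_le_mono2)
    then have q8: "8 * deficiency G A \<le> n" using q by linarith
    have "near_full G A ?W k s"
    proof
      have "card (verts G - A - ?W) = n - k - card ?W"
        using fV G A fA by (subst card_Diff_subset) (auto simp: card_Diff_subset)
      then show "k + 5 \<le> card ?W"
        using card_not_common_nbr_le[OF G(1) A(1)] q8 n by linarith
      fix a assume a: "a \<in> A"
      have "8 * 1 * (n - degree G a) \<le> 8 * k * b * (n - degree G a)"
        using b \<open>k \<ge> 1\<close> by (intro mult_le_mono1 mult_le_mono) auto
      then have "8 * (n - degree G a) \<le> n" using A(3)[OF a] by linarith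
      then show "s + (2 * k + 3) \<le> degree G a" using n by linarith
    qed (use G A \<open>k \<ge> 1\<close> in auto)
    moreover have "4 * deficiency G A * b \<le> n - 1" using q n by (simp add: mult_ac)
    ultimately show "\<exists>A. near_full G A {w \<in> verts G - A. A \<subseteq> nbr G w} k s \<and>
      4 * deficiency G A * (8 * (k + 1) ^ r * (2 * (l + s) + 1)) \<le> n - 1"
      unfolding b_def by blast
  qed
qed

text \<open>The lower bound for \<open>T n\<close> gives every competitor \<open>k\<close> vertices
  of almost full degree; then \<open>less\<close> rules out a positive deficiency and
  \<open>iso\<close> settles deficiency 0. The threshold with \<open>(k + 1) ^ r\<close> covers both
  values \<open>k\<close> and \<open>k + 1\<close> of the outside degree bound.\<close>

lemma extremal_of_near_full:
  fixes T :: "nat \<Rightarrow> nat graph"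
  assumes k: "k \<ge> 1" "r \<ge> 2" and l: "l = 2 * k + 2 \<or> l = 2 * k + 3"
    and T: "\<And>n. k + 2 \<le> n \<Longrightarrow> nvertex_graph n (T n)" "\<And>n. \<not> contains (T n) (broom l s)"
      "\<And>n. k + 2 \<le> n \<Longrightarrow> k * (n - 1) ^ r \<le> e_r r (T n)"
    and less: "\<And>(G :: nat graph) A W. near_full G A W k s \<Longrightarrow> \<not> contains G (broom l s) \<Longrightarrow> k + 2 \<le> card (verts G) \<Longrightarrow>
      1 \<le> deficiency G A \<Longrightarrow> 4 * deficiency G A * (8 * (k + 1) ^ r * (2 * (l + s) + 1)) \<le> card (verts G) - 1 \<Longrightarrow>
      2 * (k + 1) ^ r < card (verts G) - 1 \<Longrightarrow> e_r r G < e_r r (T (card (verts G)))"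
    and iso: "\<And>(G :: nat graph) A W. near_full G A W k s \<Longrightarrow> \<not> contains G (broom l s) \<Longrightarrow> k + 2 \<le> card (verts G) \<Longrightarrow>
      deficiency G A = 0 \<Longrightarrow> e_r r (T (card (verts G))) \<le> e_r r G \<Longrightarrow>
      isomorphic G (T (card (verts G))) \<and> e_r r G = e_r r (T (card (verts G)))"
  shows "\<exists>N. \<forall>n\<ge>N. ex_r r n (broom l s) = e_r r (T n) \<and> extremal r n (broom l s) (T n) \<and>
    (\<forall>G. extremal r n (broom l s) G \<longrightarrow> isomorphic G (T n))"
proof -
  obtain N where N: "\<forall>n\<ge>N. \<forall>G :: nat graph. nvertex_graph n G \<longrightarrow> \<not> contains G (broom l s) \<longrightarrow>
    k * (n - 1) ^ r \<le> e_r r G \<longrightarrow>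
    (\<exists>A. near_full G A {w \<in> verts G - A. A \<subseteq> nbr G w} k s \<and> 4 * deficiency G A * (8 * (k + 1) ^ r * (2 * (l + s) + 1)) \<le> n - 1)"
    using near_full_structure[OF k l] by (rule exE)
  show ?thesis
  proof (intro exI[of _ "N + k + 2 * (k + 1) ^ r + 3"] allI impI, rule extremalI)
    fix n assume "N + k + 2 * (k + 1) ^ r + 3 \<le> n"
    then have n: "k + 2 \<le> n" "n \<ge> N" "2 * (k + 1) ^ r < n - 1" by auto
    show "nvertex_graph n (T n)" "\<not> contains (T n) (broom l s)" using T n by auto
    fix G :: "nat graph"
    assume G: "nvertex_graph n G" and free: "\<not> contains G (broom l s)"
      and le: "e_r r (T n) \<le> e_r r G"
    have card: "card (verts G) = n" using G by (simp add: nvertex_graph_def)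
    have "k * (n - 1) ^ r \<le> e_r r G" using T(3)[OF n(1)] le by linarith
    with N[rule_format, OF n(2) G free] obtain A where
      A: "near_full G A {w \<in> verts G - A. A \<subseteq> nbr G w} k s" and small: "4 * deficiency G A * (8 * (k + 1) ^ r * (2 * (l + s) + 1)) \<le> n - 1"
      by blast
    have "\<not> 1 \<le> deficiency G A"
      using less[OF A free, unfolded card, OF n(1) _ small[unfolded card] n(3)] le unfolding card by linarith
    then have "deficiency G A = 0" by linarith
    then show "isomorphic G (T n) \<and> e_r r G = e_r r (T n)"
      using iso[OF A free, unfolded card, OF n(1) _ le] unfolding card by blast
  qed
qed

lemma extremal_broom_even:
  assumes "k \<ge> 1" "r \<ge> 2"
  shows "\<exists>N. \<forall>n\<ge>N. ex_r r n (broom (2 * k + 2) s) = e_r r (H_graph k n) \<and>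
    extremal r n (broom (2 * k + 2) s) (H_graph k n) \<and>
    (\<forall>G. extremal r n (broom (2 * k + 2) s) G \<longrightarrow> isomorphic G (H_graph k n))"
proof (rule extremal_of_near_full[OF assms])
  show "k * (n - 1) ^ r \<le> e_r r (H_graph k n)" if "k + 2 \<le> n" for n
    using e_r_H_graph_ge[of k n r] that by linarith
  fix G :: "nat graph" and A W
  assume nf: "near_full G A W k s" and free: "\<not> contains G (broom (2 * k + 2) s)"
    and n: "k + 2 \<le> card (verts G)"
  let ?n = "card (verts G)"
  show "isomorphic G (H_graph k ?n) \<and> e_r r G = e_r r (H_graph k ?n)"
    if "deficiency G A = 0" "e_r r (H_graph k ?n) \<le> e_r r G"
    using near_full.isomorphic_even[OF nf refl free that(1) _ that(2)] assms by simp
  assume q: "1 \<le> deficiency G A"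
    "4 * deficiency G A * (8 * (k + 1) ^ r * (2 * (2 * k + 2 + s) + 1)) \<le> ?n - 1" "2 * (k + 1) ^ r < ?n - 1"
  have "2 * k ^ r < ?n - 1" using q(3) power_mono[of k "k + 1" r] by linarith
  from near_full.e_r_less_even[OF nf assms(2) free q(1,2) this]
  show "e_r r G < e_r r (H_graph k ?n)" using e_r_H_graph_ge[of k ?n r] n by linarith
qed (simp_all add: nvertex_H_graph H_graph_broom_free del: add_2_eq_Suc')

lemma extremal_broom_odd:
  assumes "k \<ge> 1" "r \<ge> 2" "k \<ge> 2 \<or> s = 0"
  shows "\<exists>N. \<forall>n\<ge>N. ex_r r n (broom (2 * k + 3) s) = e_r r (H_star k n) \<and>
    extremal r n (broom (2 * k + 3) s) (H_star k n) \<and>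
    (\<forall>G. extremal r n (broom (2 * k + 3) s) G \<longrightarrow> isomorphic G (H_star k n))"
proof (rule extremal_of_near_full[OF assms(1,2)])
  show "k * (n - 1) ^ r \<le> e_r r (H_star k n)" if "k + 2 \<le> n" for n
    using e_r_H_star_ge[of k n r] that by linarith
  fix G :: "nat graph" and A W
  assume nf: "near_full G A W k s" and free: "\<not> contains G (broom (2 * k + 3) s)"
    and n: "k + 2 \<le> card (verts G)"
  let ?n = "card (verts G)"
  show "isomorphic G (H_star k ?n) \<and> e_r r G = e_r r (H_star k ?n)"
    if "deficiency G A = 0" "e_r r (H_star k ?n) \<le> e_r r G"
    using near_full.isomorphic_odd[OF nf refl free that(1) assms(3) _ _ that(2)] assms n by simp
  assume q: "1 \<le> deficiency G A"
    "4 * deficiency G A * (8 * (k + 1) ^ r * (2 * (2 * k + 3 + s) + 1)) \<le> ?n - 1" "2 * (k + 1) ^ r < ?n - 1"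
  have "2 * k ^ r < ?n - 1" using q(3) power_mono[of k "k + 1" r] by linarith
  from near_full.e_r_less_odd[OF nf assms(2) free q(1) assms(3) q(2) this]
  show "e_r r G < e_r r (H_star k ?n)" using e_r_H_star_ge[of k ?n r] n by linarith
qed (simp_all add: nvertex_H_star H_star_broom_free)

lemma extremal_broom_5:
  assumes "r \<ge> 2" "s > 0"
  shows "\<exists>N. \<forall>n\<ge>N. ex_r r n (broom 5 s) = e_r r (F_graph n) \<and>
    extremal r n (broom 5 s) (F_graph n) \<and>
    (\<forall>G. extremal r n (broom 5 s) G \<longrightarrow> isomorphic G (F_graph n))"
proof (rule extremal_of_near_full[OF order_refl assms(1)])
  show "1 * (n - 1) ^ r \<le> e_r r (F_graph n)" if "1 + 2 \<le> n" for n
    using e_r_F_graph_ge[of n r] that by linarith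
  fix G :: "nat graph" and A W
  assume nf: "near_full G A W 1 s" and free: "\<not> contains G (broom 5 s)"
    and n: "1 + 2 \<le> card (verts G)"
  let ?n = "card (verts G)"
  have free': "\<not> contains G (broom (2 * 1 + 3) s)" using free by simp
  show "isomorphic G (F_graph ?n) \<and> e_r r G = e_r r (F_graph ?n)"
    if "deficiency G A = 0" "e_r r (F_graph ?n) \<le> e_r r G"
    using near_full.isomorphic_matching[OF nf refl free' that(1) refl _ that(2)] assms by simp
  assume q: "1 \<le> deficiency G A"
    "4 * deficiency G A * (8 * (1 + 1) ^ r * (2 * (5 + s) + 1)) \<le> ?n - 1" "2 * (1 + 1) ^ r < ?n - 1"
  have "2 * 1 + 3 + s = 5 + s" by simp
  note near_full.e_r_less_matching[OF nf assms(1) free' q(1), unfolded this, OF q(2,3)]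
  \<comment> \<open>The spare \<open>2 ^ r\<close> compensates for the \<open>n - 2\<close> in place
    of \<open>n - 1\<close> in the lower bound for \<open>F_graph\<close>, where a possibly
    unmatched vertex is dropped.\<close>
  then have "e_r r G + 2 ^ r < (?n - 1) ^ r + (?n - 1) * 2 ^ r" by (simp only: one_add_one mult_1)
  moreover have "?n - 1 = Suc (?n - 2)" using n by simp
  then have "(?n - 1) * 2 ^ r = (?n - 2) * 2 ^ r + 2 ^ r" by simp
  ultimately show "e_r r G < e_r r (F_graph ?n)" using e_r_F_graph_ge[of ?n r] n by linarith
qed (simp_all add: nvertex_F_graph F_graph_broom_free assms)

theorem theorem1p1:
  fixes l s r :: nat
  assumes "l \<ge> 4" and "r \<ge> 2"
  defines "k \<equiv> (l - 2) div 2"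
  shows "\<exists>N. \<forall>n\<ge>N.
    (even l \<longrightarrow>
       ex_r r n (broom l s) = e_r r (H_graph k n) \<and> extremal r n (broom l s) (H_graph k n) \<and>
       (\<forall>G. extremal r n (broom l s) G \<longrightarrow> isomorphic G (H_graph k n))) \<and>
    (odd l \<and> (l \<ge> 7 \<or> (l = 5 \<and> s = 0)) \<longrightarrow>
       ex_r r n (broom l s) = e_r r (H_star k n) \<and> extremal r n (broom l s) (H_star k n) \<and>
       (\<forall>G. extremal r n (broom l s) G \<longrightarrow> isomorphic G (H_star k n))) \<and>
    (l = 5 \<and> s > 0 \<longrightarrow>
       ex_r r n (broom l s) = e_r r (F_graph n) \<and> extremal r n (broom l s) (F_graph n) \<and>
       (\<forall>G. extremal r n (broom l s) G \<longrightarrow> isomorphic G (F_graph n)))"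
proof -
  have k1: "k \<ge> 1" using assms(1) unfolding k_def by linarith
  have "l = 4 \<or> l = 5 \<or> l = 6 \<or> l \<ge> 7" using assms(1) by linarith
  then consider "even l" | "odd l" "l \<ge> 7 \<or> (l = 5 \<and> s = 0)" | "l = 5" "s > 0"
    by (cases "s = 0") auto
  then show ?thesis
  proof cases
    case 1
    then have l: "2 * k + 2 = l" "l \<noteq> 5" using assms(1) unfolding k_def by presburger+
    note extremal_broom_even[OF k1 assms(2), of s, unfolded l(1)]
    then show ?thesis by (rule ex_forward) (use 1 l(2) in blast)
  next
    case 2
    then have l: "2 * k + 3 = l" "\<not> (l = 5 \<and> s > 0)"
      unfolding k_def by presburger+
    then have ks: "k \<ge> 2 \<or> s = 0" using 2 by linarith
    note extremal_broom_odd[OF k1 assms(2) ks, unfolded l(1)]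
    then show ?thesis by (rule ex_forward) (use 2 l(2) in blast)
  next
    case 3
    then have l: "odd l" "\<not> (l \<ge> 7 \<or> (l = 5 \<and> s = 0))" by simp_all
    note extremal_broom_5[OF assms(2) \<open>s > 0\<close>, folded \<open>l = 5\<close>]
    then show ?thesis by (rule ex_forward) (use 3 l in blast)
  qed
qed

end
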